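(* Let $k\ge1$ be a fixed constant and let $f\in\mathcal{D}^{(k)}$. Then $\bar{\mathrm{R}}_\varepsilon(f)\le\tilde{O}(\varepsilon^{-1/(k+1)})$, where the hidden constant may depend on $k$.
   Context: $\mathcal{D}^{(k)}$ is the set of $k$-times differentiable functions $f:[0,1]^2\to[-1,1]$ all of whose $k$-th order partial derivatives $\partial^k f/\partial x^i\partial y^{k-i}$ ($0\le i\le k$) take values in $[-1,1]$. Distributed estimation: Alice holds a probability distribution $p$ on $[0,1]$, Bob a probability distribution $q$ on $[0,1]$, and they must output an estimate within additive error $\varepsilon$ of $\mathbb{E}_{x\sim p,y\sim q}[f(x,y)]$. $\bar{\mathrm{R}}_\varepsilon(f)$ is the minimum worst-case communication of a shared-randomness randomized protocol succeeding with probability at least $2/3$ on every input pair. $\tilde{O}$ hides polylogarithmic factors in $1/\varepsilon$ only. *)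

theory Defs
  imports "HOL-Probability.Probability"
begin

abbreviation unit_square :: "(real \<times> real) set" where
  "unit_square \<equiv> {0..1} \<times> {0..1}"

text \<open>Derivatives are taken within the closed square, hence one-sided on its boundary; values of
  functions outside the square never matter.\<close>

definition partial_x :: "(real \<times> real \<Rightarrow> real) \<Rightarrow> real \<times> real \<Rightarrow> real" where
  "partial_x f = (\<lambda>(x, y). vector_derivative (\<lambda>t. f (t, y)) (at x within {0..1}))"

definition partial_y :: "(real \<times> real \<Rightarrow> real) \<Rightarrow> real \<times> real \<Rightarrow> real" where
  "partial_y f = (\<lambda>(x, y). vector_derivative (\<lambda>t. f (x, t)) (at y within {0..1}))"

text \<open>Iterated total (Frechet) differentiability: the total derivative of \<open>f\<close> is
  \<open>m\<close> times differentiable iff both of its components, the partial derivatives, are.\<close>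

primrec times_differentiable :: "nat \<Rightarrow> (real \<times> real \<Rightarrow> real) \<Rightarrow> bool" where
  "times_differentiable 0 f \<longleftrightarrow> True"
| "times_differentiable (Suc m) f \<longleftrightarrow>
     f differentiable_on unit_square \<and>
     times_differentiable m (partial_x f) \<and> times_differentiable m (partial_y f)"

definition smooth_class :: "nat \<Rightarrow> (real \<times> real \<Rightarrow> real) set" where
  "smooth_class k = {f.
     times_differentiable k f \<and>
     (\<forall>z\<in>unit_square. f z \<in> {-1..1}) \<and>
     (\<forall>i\<le>k. \<forall>z\<in>unit_square. (partial_x ^^ i) ((partial_y ^^ (k - i)) f) z \<in> {-1..1})}"

text \<open>Deterministic two-party protocol trees. At each inner node the named party sends one bit,
  computed from its own input; the estimate is determined by the transcript, so both parties
  know it.\<close>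

datatype ('a, 'b) protocol =
    Output real
  | Alice "'a \<Rightarrow> bool" "('a, 'b) protocol" "('a, 'b) protocol"
  | Bob "'b \<Rightarrow> bool" "('a, 'b) protocol" "('a, 'b) protocol"

primrec run :: "('a, 'b) protocol \<Rightarrow> 'a \<Rightarrow> 'b \<Rightarrow> real" where
  "run (Output v) a b = v"
| "run (Alice s P Q) a b = (if s a then run P a b else run Q a b)"
| "run (Bob s P Q) a b = (if s b then run P a b else run Q a b)"

primrec bits :: "('a, 'b) protocol \<Rightarrow> 'a \<Rightarrow> 'b \<Rightarrow> nat" where
  "bits (Output v) a b = 0"
| "bits (Alice s P Q) a b = Suc (if s a then bits P a b else bits Q a b)"
| "bits (Bob s P Q) a b = Suc (if s b then bits P a b else bits Q a b)"

definition unit_distributions :: "real measure set" where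
  "unit_distributions = space (prob_algebra (restrict_space borel {0..1}))"

text \<open>A shared-randomness protocol is a family of deterministic protocols indexed by a random
  seed. The seed may have any Borel distribution on the reals, which covers infinite sequences of
  fair coin flips as well as every discrete distribution.\<close>

type_synonym shared_protocol = "real \<Rightarrow> (real measure, real measure) protocol"

definition solves :: "(real \<times> real \<Rightarrow> real) \<Rightarrow> real \<Rightarrow> real measure \<Rightarrow> shared_protocol \<Rightarrow> bool" where
  "solves f \<epsilon> M \<pi> \<longleftrightarrow>
     real_distribution M \<and>
     (\<forall>p\<in>unit_distributions. \<forall>q\<in>unit_distributions.
        (\<lambda>r. run (\<pi> r) p q) \<in> borel_measurable M \<and>
        \<P>(r in M. \<bar>run (\<pi> r) p q - integral\<^sup>L (p \<Otimes>\<^sub>M q) f\<bar> \<le> \<epsilon>) \<ge> 2 / 3)"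

definition worst_case_comm :: "shared_protocol \<Rightarrow> enat" where
  "worst_case_comm \<pi> =
     (SUP r. SUP p\<in>unit_distributions. SUP q\<in>unit_distributions. enat (bits (\<pi> r) p q))"

text \<open>The infimum is a minimum since \<^typ>\<open>enat\<close> is well-ordered; it is infinite if no protocol
  of bounded communication solves the task.\<close>

definition rand_comm :: "real \<Rightarrow> (real \<times> real \<Rightarrow> real) \<Rightarrow> enat" where
  "rand_comm \<epsilon> f = Inf {worst_case_comm \<pi> | M \<pi>. solves f \<epsilon> M \<pi>}"

end

theory Submission
  imports Defs
begin

text \<open>
  Cut \<open>[0,1]\<close> into \<open>m\<close> cells. Taylor expansion in \<open>x\<close> approximates \<open>f\<close> up to \<open>\<eta> = m\<^sup>-\<^sup>k\<close> by a sum \<open>g\<close> of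
  \<open>O(m)\<close> products \<open>\<phi>(x) \<psi>(y)\<close>, so \<open>E g\<close> costs Alice \<open>O(m)\<close> rounded moments.
  For the remainder \<open>h = f - g\<close> both parties exchange \<open>s\<close> samples, with empirical distributions
  \<open>p'\<close> and \<open>q'\<close>, and output \<open>h(p', q) + h(p, q') - h(p', q')\<close> (bilinear extension): Bob can compute the
  first term and Alice the second. The error is \<open>h(p - p', q - q')\<close> up to sign, a degenerate U-statistic with
  standard deviation \<open>O(\<eta> / s)\<close> rather than \<open>O(\<eta> / \<surd>s)\<close>. With \<open>m\<close> and \<open>s\<close> of order
  \<open>\<epsilon> powr (- 1 / (k + 1))\<close> this is \<open>O(\<epsilon>)\<close>.

  Samples are transmitted as points of a grid of mesh \<open>O(\<epsilon>)\<close>, which is harmless because \<open>f\<close> is Lipschitz with a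
  constant depending only on \<open>k\<close> (Landau-Kolmogorov). To sample from the finite seed, each party replaces
  its distribution by a uniform one on \<open>K\<close> grid points, with repetitions.
\<close>

section \<open>Debiased sampling\<close>

lemma expectation_bind_pmf_finite:
  fixes h :: "'b \<Rightarrow> real"
  assumes "finite (set_pmf p)" "\<And>x. x \<in> set_pmf p \<Longrightarrow> finite (set_pmf (F x))"
  shows "measure_pmf.expectation (bind_pmf p F) h
    = measure_pmf.expectation p (\<lambda>x. measure_pmf.expectation (F x) h)"
  using assms
  by (subst pmf_expectation_bind[OF assms(1)]) (auto simp: integral_measure_pmf[of "set_pmf p"])

lemma expectation_pair_pmf_finite:
  fixes h :: "'a \<times> 'b \<Rightarrow> real"
  assumes "finite (set_pmf p)" "finite (set_pmf q)"
  shows "measure_pmf.expectation (pair_pmf p q) h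
    = measure_pmf.expectation p (\<lambda>x. measure_pmf.expectation q (\<lambda>y. h (x, y)))"
  unfolding pair_pmf_def using assms by (simp add: expectation_bind_pmf_finite)

lemma expectation_swap_finite:
  fixes h :: "'a \<Rightarrow> 'b \<Rightarrow> real"
  assumes "finite (set_pmf p)" "finite (set_pmf q)"
  shows "measure_pmf.expectation p (\<lambda>x. measure_pmf.expectation q (h x))
    = measure_pmf.expectation q (\<lambda>y. measure_pmf.expectation p (\<lambda>x. h x y))"
  using assms
  by (simp add: integral_measure_pmf[of "set_pmf p"] integral_measure_pmf[of "set_pmf q"]
      sum_distrib_left mult.left_commute sum.swap[of _ "set_pmf p"])

lemma abs_expectation_le:
  fixes h :: "'a \<Rightarrow> real"
  assumes "finite (set_pmf p)" "\<And>x. x \<in> set_pmf p \<Longrightarrow> \<bar>h x\<bar> \<le> B"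
  shows "\<bar>measure_pmf.expectation p h\<bar> \<le> B"
proof -
  have "\<bar>measure_pmf.expectation p h\<bar> \<le> measure_pmf.expectation p (\<lambda>x. \<bar>h x\<bar>)"
    using integral_norm_bound[of "measure_pmf p" h] by simp
  also have "\<dots> \<le> measure_pmf.expectation p (\<lambda>_. B)"
    using assms by (intro integral_mono_AE) (auto simp: integrable_measure_pmf_finite AE_measure_pmf_iff)
  finally show ?thesis by simp
qed

section \<open>Moments of sums over independent samples\<close>

lemma finite_set_replicate_pmf [simp]: "finite (set_pmf U) \<Longrightarrow> finite (set_pmf (replicate_pmf n U))"
  using finite_lists_length_eq[of "set_pmf U" n] by (simp add: set_replicate_pmf lists_eq_set)

lemma expectation_replicate_Suc:
  fixes h :: "'a list \<Rightarrow> real"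
  assumes "finite (set_pmf U)"
  shows "measure_pmf.expectation (replicate_pmf (Suc n) U) h = measure_pmf.expectation U
    (\<lambda>x. measure_pmf.expectation (replicate_pmf n U) (\<lambda>xs. h (x # xs)))"
  using assms by (simp add: expectation_bind_pmf_finite)

lemma expectation_sum_list_replicate:
  fixes c :: "'a \<Rightarrow> real"
  assumes fin: "finite (set_pmf U)" and c: "measure_pmf.expectation U c = 0"
  shows "measure_pmf.expectation (replicate_pmf n U) (\<lambda>xs. \<Sum>x\<leftarrow>xs. c x) = 0"
proof (induction n)
  case (Suc n)
  then show ?case
    using fin c by (simp only: expectation_replicate_Suc) (simp add: integrable_measure_pmf_finite)
qed simp

text \<open>Variances of independent centred terms add: when one sample is split off, the cross term
  has mean zero.\<close>

lemma expectation_sum_list_replicate_sq: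
  fixes c :: "'a \<Rightarrow> real"
  assumes fin: "finite (set_pmf U)" and c: "measure_pmf.expectation U c = 0"
  shows "measure_pmf.expectation (replicate_pmf n U) (\<lambda>xs. (\<Sum>x\<leftarrow>xs. c x)\<^sup>2)
    = real n * measure_pmf.expectation U (\<lambda>x. (c x)\<^sup>2)"
proof (induction n)
  case (Suc n)
  have "measure_pmf.expectation (replicate_pmf n U) (\<lambda>xs. (c x + (\<Sum>x\<leftarrow>xs. c x))\<^sup>2)
    = (c x)\<^sup>2 + real n * measure_pmf.expectation U (\<lambda>x. (c x)\<^sup>2)" for x
    using fin Suc expectation_sum_list_replicate[OF assms, of n]
    by (simp add: power2_sum integrable_measure_pmf_finite mult.assoc)
  then show ?case
    using fin by (simp only: expectation_replicate_Suc)
      (simp add: integrable_measure_pmf_finite algebra_simps)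
qed simp

lemma expectation_sum_list [simp]:
  fixes h :: "'a \<Rightarrow> 'b \<Rightarrow> real"
  assumes "finite (set_pmf p)"
  shows "measure_pmf.expectation p (\<lambda>x. \<Sum>y\<leftarrow>ys. h x y) = (\<Sum>y\<leftarrow>ys. measure_pmf.expectation p (\<lambda>x. h x y))"
  using assms by (induction ys) (simp_all add: integrable_measure_pmf_finite)

text \<open>As \<open>h\<close> is centred in each variable separately, the variance formula applies
  twice, first to \<open>us\<close> for fixed \<open>vs\<close> and then to \<open>vs\<close> for
  fixed \<open>u\<close>. Of the s^4 products in the expanded square only the s^2 diagonal ones
  contribute.\<close>

lemma degenerate_second_moment:
  fixes h :: "'a \<Rightarrow> 'b \<Rightarrow> real"
  assumes fin: "finite (set_pmf U)" "finite (set_pmf V)"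
    and row: "\<And>u. measure_pmf.expectation V (h u) = 0"
    and col: "\<And>v. measure_pmf.expectation U (\<lambda>u. h u v) = 0"
  shows "measure_pmf.expectation (pair_pmf (replicate_pmf s U) (replicate_pmf s V))
      (\<lambda>(us, vs). (\<Sum>u\<leftarrow>us. \<Sum>v\<leftarrow>vs. h u v)\<^sup>2)
    = (real s)\<^sup>2 * measure_pmf.expectation U (\<lambda>u. measure_pmf.expectation V (\<lambda>v. (h u v)\<^sup>2))"
proof -
  have 1: "measure_pmf.expectation (replicate_pmf s U) (\<lambda>us. (\<Sum>u\<leftarrow>us. \<Sum>v\<leftarrow>vs. h u v)\<^sup>2)
      = real s * measure_pmf.expectation U (\<lambda>u. (\<Sum>v\<leftarrow>vs. h u v)\<^sup>2)" for vs
    using fin by (intro expectation_sum_list_replicate_sq) (simp_all add: col)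
  have "measure_pmf.expectation (pair_pmf (replicate_pmf s U) (replicate_pmf s V))
      (\<lambda>(us, vs). (\<Sum>u\<leftarrow>us. \<Sum>v\<leftarrow>vs. h u v)\<^sup>2)
    = real s * measure_pmf.expectation U
        (\<lambda>u. measure_pmf.expectation (replicate_pmf s V) (\<lambda>vs. (\<Sum>v\<leftarrow>vs. h u v)\<^sup>2))"
    using fin by (simp add: expectation_pair_pmf_finite expectation_swap_finite[of "replicate_pmf s U"] 1
        expectation_swap_finite[of "replicate_pmf s V"])
  also have "\<dots> = real s * measure_pmf.expectation U
      (\<lambda>u. real s * measure_pmf.expectation V (\<lambda>v. (h u v)\<^sup>2))"
    by (simp only: expectation_sum_list_replicate_sq[OF fin(2) row])
  finally show ?thesis by (simp add: power2_eq_square mult.assoc)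
qed

text \<open>The error is exactly minus the average of a doubly centred kernel over all s^2 sample
  pairs, because the linear terms of the Hoeffding decomposition cancel. Its second moment is at
  most 16 \<eta>^2 / s^2, and Chebyshev's inequality gives the probability.\<close>

lemma debiased_estimator:
  fixes H :: "'a \<Rightarrow> 'b \<Rightarrow> real" and U :: "'a pmf" and V :: "'b pmf"
  defines "Er \<equiv> \<lambda>u. measure_pmf.expectation V (H u)"
    and "Ec \<equiv> \<lambda>v. measure_pmf.expectation U (\<lambda>u. H u v)"
  assumes fin: "finite (set_pmf U)" "finite (set_pmf V)"
    and H: "\<And>u v. \<bar>H u v\<bar> \<le> \<eta>"
    and s: "0 < s" and \<epsilon>: "0 < \<epsilon>" "7 * \<eta> \<le> \<epsilon> * real s"
  shows "measure_pmf.prob (pair_pmf (replicate_pmf s U) (replicate_pmf s V))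
    {(us, vs). \<bar>(\<Sum>u\<leftarrow>us. Er u) / s + (\<Sum>v\<leftarrow>vs. Ec v) / s - (\<Sum>u\<leftarrow>us. \<Sum>v\<leftarrow>vs. H u v) / (real s)\<^sup>2
       - measure_pmf.expectation U Er\<bar> \<le> \<epsilon>} \<ge> 2 / 3"
proof -
  define P where "P = pair_pmf (replicate_pmf s U) (replicate_pmf s V)"
  define \<mu> where "\<mu> = measure_pmf.expectation U Er"
  \<comment> \<open>Subtracting both marginal means and adding back the overall mean makes every row
    mean and every column mean vanish.\<close>
  define h where "h = (\<lambda>u v. H u v - Er u - Ec v + \<mu>)"
  define S where "S = (\<lambda>(us, vs). \<Sum>u\<leftarrow>us. \<Sum>v\<leftarrow>vs. h u v)"
  note int = integrable_measure_pmf_finite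
  have \<mu>': "\<mu> = measure_pmf.expectation V Ec"
    unfolding \<mu>_def Er_def Ec_def using fin by (rule expectation_swap_finite)
  have finP: "finite (set_pmf P)" using fin by (simp add: P_def)
  have bounds: "\<bar>Er u\<bar> \<le> \<eta>" "\<bar>Ec v\<bar> \<le> \<eta>" "\<bar>\<mu>\<bar> \<le> \<eta>" for u v
    unfolding Er_def Ec_def \<mu>_def using fin H by (intro abs_expectation_le; simp)+
  have h: "\<bar>h u v\<bar> \<le> 4 * \<eta>" for u v
    using H[of u v] bounds(1)[of u] bounds(2)[of v] bounds(3) unfolding h_def by linarith
  have row: "measure_pmf.expectation V (h u) = 0" for u
    using fin by (simp add: h_def[abs_def] int Er_def \<mu>'[symmetric])
  have col: "measure_pmf.expectation U (\<lambda>u. h u v) = 0" for v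
    using fin by (simp add: h_def int Ec_def \<mu>_def[symmetric])
  have "measure_pmf.expectation P (\<lambda>w. (S w)\<^sup>2)
    = (real s)\<^sup>2 * measure_pmf.expectation U (\<lambda>u. measure_pmf.expectation V (\<lambda>v. (h u v)\<^sup>2))"
    unfolding P_def S_def using degenerate_second_moment[OF fin row col] by (simp add: case_prod_unfold)
  also have "\<dots> \<le> (real s)\<^sup>2 * (4 * \<eta>)\<^sup>2"
  proof (rule mult_left_mono)
    have h2: "\<bar>(h u v)\<^sup>2\<bar> \<le> (4 * \<eta>)\<^sup>2" for u v
      using power_mono[OF h[of u v], of 2] by simp
    have "\<bar>measure_pmf.expectation U (\<lambda>u. measure_pmf.expectation V (\<lambda>v. (h u v)\<^sup>2))\<bar> \<le> (4 * \<eta>)\<^sup>2"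
      by (rule abs_expectation_le[OF fin(1)], rule abs_expectation_le[OF fin(2)], rule h2)
    then show "measure_pmf.expectation U (\<lambda>u. measure_pmf.expectation V (\<lambda>v. (h u v)\<^sup>2)) \<le> (4 * \<eta>)\<^sup>2"
      by linarith
  qed simp
  finally have var: "measure_pmf.expectation P (\<lambda>w. (S w)\<^sup>2) \<le> (real s)\<^sup>2 * (4 * \<eta>)\<^sup>2" .
  \<comment> \<open>\<open>B\<close> is the squared threshold for \<open>S\<close>. The factor 7 in
    the hypothesis is chosen since 49 exceeds 3 * 16, which brings the Markov bound below
    1/3.\<close>
  define B where "B = ((real s)\<^sup>2 * \<epsilon>)\<^sup>2"
  have B0: "0 < B" using s \<epsilon> by (simp add: B_def)
  have "(7 * \<eta>)\<^sup>2 \<le> (\<epsilon> * real s)\<^sup>2"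
    using \<epsilon>(2) bounds(3) by (intro power_mono) auto
  then have "(real s)\<^sup>2 * (7 * \<eta>)\<^sup>2 \<le> (real s)\<^sup>2 * (\<epsilon> * real s)\<^sup>2" by (intro mult_left_mono) auto
  then have "49 * ((real s)\<^sup>2 * \<eta>\<^sup>2) \<le> B"
    by (simp add: B_def power_mult_distrib power2_eq_square algebra_simps)
  moreover have "0 \<le> (real s)\<^sup>2 * \<eta>\<^sup>2" by simp
  moreover have "3 * ((real s)\<^sup>2 * (4 * \<eta>)\<^sup>2) = 48 * ((real s)\<^sup>2 * \<eta>\<^sup>2)" by (simp add: power_mult_distrib)
  ultimately have "3 * ((real s)\<^sup>2 * (4 * \<eta>)\<^sup>2) \<le> B" by linarith
  with var have EB: "measure_pmf.expectation P (\<lambda>w. (S w)\<^sup>2) / B \<le> 1 / 3"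
    using B0 by (simp add: field_simps)
  have "measure_pmf.prob P {w \<in> space (measure_pmf P). B \<le> (S w)\<^sup>2} \<le> measure_pmf.expectation P (\<lambda>w. (S w)\<^sup>2) / B"
    using B0 by (intro integral_Markov_inequality_measure[where A = "{}"] int finP) auto
  then have "measure_pmf.prob P {w. B \<le> (S w)\<^sup>2} \<le> measure_pmf.expectation P (\<lambda>w. (S w)\<^sup>2) / B" by simp
  with EB have "measure_pmf.prob P {w. B \<le> (S w)\<^sup>2} \<le> 1 / 3" by linarith
  moreover have "measure_pmf.prob P (- {w. B \<le> (S w)\<^sup>2}) = 1 - measure_pmf.prob P {w. B \<le> (S w)\<^sup>2}"
    using measure_pmf.prob_compl[of "{w. B \<le> (S w)\<^sup>2}" P] by (simp add: Compl_eq_Diff_UNIV)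
  moreover have "measure_pmf.prob P (- {w. B \<le> (S w)\<^sup>2}) \<le> measure_pmf.prob P {(us, vs).
      \<bar>(\<Sum>u\<leftarrow>us. Er u) / s + (\<Sum>v\<leftarrow>vs. Ec v) / s - (\<Sum>u\<leftarrow>us. \<Sum>v\<leftarrow>vs. H u v) / (real s)\<^sup>2 - \<mu>\<bar> \<le> \<epsilon>}"
    (is "_ \<le> measure_pmf.prob P ?G")
  proof (rule measure_pmf.finite_measure_mono_AE)
    \<comment> \<open>The restriction to the support fixes both list lengths at \<open>s\<close>,
      which evaluates the sums of constant terms.\<close>
    have "w \<in> ?G" if "w \<in> set_pmf P" "(S w)\<^sup>2 < B" for w
    proof -
      obtain us vs where w: "w = (us, vs)" by fastforce
      have len: "length us = s" "length vs = s"
        using that(1) by (auto simp: w P_def set_replicate_pmf)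
      from that(2) have "\<bar>S (us, vs)\<bar> \<le> (real s)\<^sup>2 * \<epsilon>"
        unfolding B_def w using \<epsilon> abs_le_square_iff[of "S (us, vs)" "(real s)\<^sup>2 * \<epsilon>"] by simp
      then have le: "\<bar>S (us, vs) / (real s)\<^sup>2\<bar> \<le> \<epsilon>" using s by (simp add: field_simps)
      have "S (us, vs) = (\<Sum>u\<leftarrow>us. \<Sum>v\<leftarrow>vs. H u v) - s * (\<Sum>u\<leftarrow>us. Er u) - s * (\<Sum>v\<leftarrow>vs. Ec v)
          + (real s)\<^sup>2 * \<mu>"
        by (simp add: S_def h_def sum_list_addf sum_list_subtractf sum_list_triv len power2_eq_square
            sum_list_const_mult mult.assoc)
      then have "(\<Sum>u\<leftarrow>us. Er u) / s + (\<Sum>v\<leftarrow>vs. Ec v) / s - (\<Sum>u\<leftarrow>us. \<Sum>v\<leftarrow>vs. H u v) / (real s)\<^sup>2 - \<mu>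
          = - (S (us, vs) / (real s)\<^sup>2)"
        using s by (simp add: add_divide_distrib diff_divide_distrib power2_eq_square)
      then show ?thesis using le by (simp add: w)
    qed
    then show "AE w in measure_pmf P. w \<in> - {w. B \<le> (S w)\<^sup>2} \<longrightarrow> w \<in> ?G"
      unfolding AE_measure_pmf_iff by (metis (no_types, lifting) ComplD mem_Collect_eq not_le)
  qed simp
  ultimately show ?thesis unfolding P_def \<mu>_def by simp
qed

section \<open>Protocols\<close>

text \<open>Each bit tells in which half of \<open>S\<close> the message lies, so \<open>n\<close>
  bits determine it and \<open>cont\<close> takes over. The bound on \<open>bits\<close> holds for
  all inputs, also where the message falls outside \<open>S\<close>, because the communication cost
  is a worst case over all seeds.\<close>

lemma exists_alice_message:
  fixes msg :: "'a \<Rightarrow> 'm" and cont :: "'m \<Rightarrow> ('a, 'b) protocol"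
  assumes "finite S" "card S \<le> 2 ^ n" "\<And>m a b. bits (cont m) a b \<le> B"
  shows "\<exists>P. (\<forall>a b. msg a \<in> S \<longrightarrow> run P a b = run (cont (msg a)) a b) \<and> (\<forall>a b. bits P a b \<le> n + B)"
  using assms(1,2)
proof (induction n arbitrary: S)
  case 0
  then consider "S = {}" | m where "S = {m}" by (metis card_1_singletonE card_0_eq le_Suc_eq le_zero_eq One_nat_def power_0)
  then show ?case using assms(3) by cases auto
next
  case (Suc n)
  obtain S1 where S1: "S1 \<subseteq> S" "card S1 = min (card S) (2 ^ n)"
    using obtain_subset_with_card_n[of "min (card S) (2 ^ n)" S] by auto
  have "finite S1" "card (S - S1) \<le> 2 ^ n"
    using S1 Suc.prems by (auto simp: card_Diff_subset finite_subset)
  with Suc.IH[of S1] Suc.IH[of "S - S1"] S1 Suc.prems obtain P Q where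
    "\<forall>a b. msg a \<in> S1 \<longrightarrow> run P a b = run (cont (msg a)) a b" "\<forall>a b. bits P a b \<le> n + B"
    "\<forall>a b. msg a \<in> S - S1 \<longrightarrow> run Q a b = run (cont (msg a)) a b" "\<forall>a b. bits Q a b \<le> n + B"
    by auto
  then show ?case by (intro exI[of _ "Alice (\<lambda>a. msg a \<in> S1) P Q"]) auto
qed

text \<open>Exchanging the two parties reduces Bob's messages to Alice's.\<close>

primrec swap_roles :: "('a, 'b) protocol \<Rightarrow> ('b, 'a) protocol" where
  "swap_roles (Output v) = Output v"
| "swap_roles (Alice t P Q) = Bob t (swap_roles P) (swap_roles Q)"
| "swap_roles (Bob t P Q) = Alice t (swap_roles P) (swap_roles Q)"

lemma run_swap_roles [simp]: "run (swap_roles P) b a = run P a b"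
  and bits_swap_roles [simp]: "bits (swap_roles P) b a = bits P a b"
  by (induction P) auto

lemma exists_bob_message:
  fixes msg :: "'b \<Rightarrow> 'm" and cont :: "'m \<Rightarrow> ('a, 'b) protocol"
  assumes "finite S" "card S \<le> 2 ^ n" "\<And>m a b. bits (cont m) a b \<le> B"
  shows "\<exists>P. (\<forall>a b. msg b \<in> S \<longrightarrow> run P a b = run (cont (msg b)) a b) \<and> (\<forall>a b. bits P a b \<le> n + B)"
proof -
  have "\<exists>P. (\<forall>b a. msg b \<in> S \<longrightarrow> run P b a = run (swap_roles (cont (msg b))) b a) \<and> (\<forall>b a. bits P b a \<le> n + B)"
    by (rule exists_alice_message[OF assms(1,2)]) (simp add: assms(3))
  then obtain P where "(\<forall>b a. msg b \<in> S \<longrightarrow> run P b a = run (swap_roles (cont (msg b))) b a)"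
    "\<forall>b a. bits P b a \<le> n + B" by blast
  then show ?thesis by (intro exI[of _ "swap_roles P"]) auto
qed

text \<open>The tree is built from the last message backwards, each round being the continuation of
  the one before. A message may depend on the sender's input and on earlier messages, whereas
  \<open>out\<close> sees only the transcript.\<close>

lemma exists_three_round_protocol:
  fixes m1 :: "'a \<Rightarrow> 'm" and m2 :: "'m \<Rightarrow> 'b \<Rightarrow> 'n" and m3 :: "'m \<Rightarrow> 'n \<Rightarrow> 'a \<Rightarrow> 'o"
    and out :: "'m \<Rightarrow> 'n \<Rightarrow> 'o \<Rightarrow> real"
  assumes "finite S1" "card S1 \<le> 2 ^ n1" "finite S2" "card S2 \<le> 2 ^ n2" "finite S3" "card S3 \<le> 2 ^ n3"
  shows "\<exists>P. (\<forall>a b. m1 a \<in> S1 \<longrightarrow> m2 (m1 a) b \<in> S2 \<longrightarrow> m3 (m1 a) (m2 (m1 a) b) a \<in> S3 \<longrightarrow>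
      run P a b = out (m1 a) (m2 (m1 a) b) (m3 (m1 a) (m2 (m1 a) b) a)) \<and>
    (\<forall>a b. bits P a b \<le> n1 + n2 + n3)"
proof -
  have "\<exists>P::('a, 'b) protocol. (\<forall>a b. m3 x y a \<in> S3 \<longrightarrow> run P a b = run (Output (out x y (m3 x y a)) :: ('a, 'b) protocol) a b)
      \<and> (\<forall>a b. bits P a b \<le> n3 + 0)" for x y
    by (rule exists_alice_message[OF assms(5,6)]) simp
  then obtain P3 :: "'m \<Rightarrow> 'n \<Rightarrow> ('a, 'b) protocol" where P3:
    "\<And>x y a b. m3 x y a \<in> S3 \<Longrightarrow> run (P3 x y) a b = out x y (m3 x y a)"
    "\<And>x y a b. bits (P3 x y) a b \<le> n3"
    by simp metis
  have "\<exists>P. (\<forall>a b. m2 x b \<in> S2 \<longrightarrow> run P a b = run (P3 x (m2 x b)) a b) \<and> (\<forall>a b. bits P a b \<le> n2 + n3)" for x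
    by (rule exists_bob_message[OF assms(3,4)]) (rule P3)
  then obtain P2 where P2:
    "\<And>x a b. m2 x b \<in> S2 \<Longrightarrow> run (P2 x) a b = run (P3 x (m2 x b)) a b"
    "\<And>x a b. bits (P2 x) a b \<le> n2 + n3"
    by metis
  have "\<exists>P. (\<forall>a b. m1 a \<in> S1 \<longrightarrow> run P a b = run (P2 (m1 a)) a b) \<and> (\<forall>a b. bits P a b \<le> n1 + (n2 + n3))"
    by (rule exists_alice_message[OF assms(1,2)]) (rule P2)
  then obtain P where "\<forall>a b. m1 a \<in> S1 \<longrightarrow> run P a b = run (P2 (m1 a)) a b"
    "\<forall>a b. bits P a b \<le> n1 + (n2 + n3)" by blast
  then show ?thesis using P2 P3 by (intro exI[of _ P]) (auto simp: add.assoc)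
qed

text \<open>A countable seed is embedded into the reals by \<open>to_nat\<close> and recovered by
  rounding down. The output of the resulting family depends on the real seed only through its floor
  and is therefore Borel measurable.\<close>

lemma rand_comm_le:
  fixes P :: "'w::countable pmf" and \<pi> :: "'w \<Rightarrow> (real measure, real measure) protocol"
  assumes bits: "\<And>w p q. bits (\<pi> w) p q \<le> n"
    and prob: "\<And>p q. p \<in> unit_distributions \<Longrightarrow> q \<in> unit_distributions \<Longrightarrow>
      measure_pmf.prob P {w. \<bar>run (\<pi> w) p q - integral\<^sup>L (p \<Otimes>\<^sub>M q) f\<bar> \<le> \<epsilon>} \<ge> 2 / 3"
  shows "rand_comm \<epsilon> f \<le> enat n"
proof -
  define M where "M = distr (measure_pmf P) borel (\<lambda>w. real (to_nat w))"
  \<comment> \<open>The decoding is total, since \<open>worst_case_comm\<close> takes the supremum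
    over every real \<open>r\<close> and not only over the support of \<open>M\<close>.\<close>
  define \<rho> where "\<rho> = (\<lambda>r::real. \<pi> (from_nat (nat \<lfloor>r\<rfloor>)))"
  have meas: "(\<lambda>r. run (\<rho> r) p q) \<in> borel_measurable borel" for p q
  proof -
    have "(\<lambda>r::real. (\<lambda>z::int. run (\<pi> (from_nat (nat z))) p q) \<lfloor>r\<rfloor>) \<in> borel_measurable borel"
      by (rule measurable_compose[OF measurable_real_floor]) simp
    then show ?thesis by (simp add: \<rho>_def)
  qed
  have "solves f \<epsilon> M \<rho>"
    unfolding solves_def
  proof (intro conjI ballI)
    show "real_distribution M"
      unfolding M_def real_distribution_def real_distribution_axioms_def
      by (auto intro!: measure_pmf.prob_space_distr)
    fix p q assume pq: "p \<in> unit_distributions" "q \<in> unit_distributions"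
    show "(\<lambda>r. run (\<rho> r) p q) \<in> borel_measurable M" using meas by (simp add: M_def)
    have "{r \<in> space M. \<bar>run (\<rho> r) p q - integral\<^sup>L (p \<Otimes>\<^sub>M q) f\<bar> \<le> \<epsilon>} \<in> sets borel"
      using meas[of p q] by (simp add: M_def)
    then have "\<P>(r in M. \<bar>run (\<rho> r) p q - integral\<^sup>L (p \<Otimes>\<^sub>M q) f\<bar> \<le> \<epsilon>)
      = measure_pmf.prob P {w. \<bar>run (\<pi> w) p q - integral\<^sup>L (p \<Otimes>\<^sub>M q) f\<bar> \<le> \<epsilon>}"
      unfolding M_def by (subst measure_distr) (auto simp: vimage_def \<rho>_def)
    then show "2 / 3 \<le> \<P>(r in M. \<bar>run (\<rho> r) p q - integral\<^sup>L (p \<Otimes>\<^sub>M q) f\<bar> \<le> \<epsilon>)"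
      using prob[OF pq] by simp
  qed
  moreover have "worst_case_comm \<rho> \<le> enat n"
    unfolding worst_case_comm_def \<rho>_def using bits by (intro SUP_least) simp
  ultimately show ?thesis
    unfolding rand_comm_def by (intro Inf_lower2[of "worst_case_comm \<rho>"]) auto
qed

section \<open>Derivative bounds\<close>

text \<open>A bound for \<open>\<bar>u\<^sup>(\<^sup>j\<^sup>)\<bar>\<close> at some point of any interval of length \<open>l\<close> when \<open>\<bar>u\<bar> \<le> 1\<close>: apply the mean value
  theorem between good points for \<open>j\<close> in the first and last third of the interval.\<close>

primrec landau_const :: "nat \<Rightarrow> real \<Rightarrow> real" where
  "landau_const 0 l = 1"
| "landau_const (Suc j) l = 6 * landau_const j (l / 3) / l"

lemma landau_const_nonneg: "0 < l \<Longrightarrow> 0 \<le> landau_const j l"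
  by (induction j arbitrary: l) auto

lemma exists_small_derivative:
  fixes u :: "nat \<Rightarrow> real \<Rightarrow> real"
  assumes deriv: "\<And>i x. i < j \<Longrightarrow> x \<in> {0..1} \<Longrightarrow> (u i has_real_derivative u (Suc i) x) (at x within {0..1})"
    and bnd: "\<And>x. x \<in> {0..1} \<Longrightarrow> \<bar>u 0 x\<bar> \<le> 1"
    and ab: "0 \<le> a" "a < b" "b \<le> 1"
  shows "\<exists>\<xi>\<in>{a..b}. \<bar>u j \<xi>\<bar> \<le> landau_const j (b - a)"
  using deriv ab
proof (induction j arbitrary: a b)
  case 0
  then show ?case using bnd by (intro bexI[of _ a]) auto
next
  case (Suc j)
  define l where "l = (b - a) / 3"
  have l: "0 < l" "b - a = 3 * l" using Suc.prems by (auto simp: l_def)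
  obtain \<xi>1 where \<xi>1: "\<xi>1 \<in> {a..a + l}" "\<bar>u j \<xi>1\<bar> \<le> landau_const j l"
    using Suc.IH[of a "a + l"] Suc.prems l by auto
  obtain \<xi>2 where \<xi>2: "\<xi>2 \<in> {b - l..b}" "\<bar>u j \<xi>2\<bar> \<le> landau_const j l"
    using Suc.IH[of "b - l" b] Suc.prems l by auto
  have gap: "l \<le> \<xi>2 - \<xi>1" using \<xi>1 \<xi>2 l by auto
  have sub: "{\<xi>1..\<xi>2} \<subseteq> {0..1}" using \<xi>1 \<xi>2 Suc.prems by auto
  have "\<exists>x\<in>{\<xi>1<..<\<xi>2}. u j \<xi>2 - u j \<xi>1 = u (Suc j) x * (\<xi>2 - \<xi>1)"
  proof (rule mvt_simple[of \<xi>1 \<xi>2 "u j" "\<lambda>x. (*) (u (Suc j) x)"])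
    fix x assume "\<xi>1 \<le> x" "x \<le> \<xi>2"
    then have "(u j has_real_derivative u (Suc j) x) (at x within {\<xi>1..\<xi>2})"
      using sub by (intro DERIV_subset[OF Suc.prems(1)]) auto
    then show "(u j has_derivative (*) (u (Suc j) x)) (at x within {\<xi>1..\<xi>2})"
      by (simp add: has_field_derivative_def)
  qed (use gap l in auto)
  then obtain x where x: "x \<in> {\<xi>1<..<\<xi>2}" "u j \<xi>2 - u j \<xi>1 = u (Suc j) x * (\<xi>2 - \<xi>1)" by blast
  \<comment> \<open>Two good values differ by at most twice the constant for length
    \<open>l\<close>, over a gap of at least \<open>l\<close>, a third of the interval. This is the
    factor 6 in \<open>landau_const\<close>.\<close>
  have "\<bar>u (Suc j) x\<bar> * l \<le> \<bar>u (Suc j) x\<bar> * (\<xi>2 - \<xi>1)" using gap by (intro mult_left_mono) auto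
  also have "\<dots> = \<bar>u j \<xi>2 - u j \<xi>1\<bar>" using x(2) gap l by (simp add: abs_mult)
  also have "\<dots> \<le> 2 * landau_const j l" using \<xi>1 \<xi>2 by linarith
  finally have "\<bar>u (Suc j) x\<bar> \<le> landau_const (Suc j) (b - a)"
    using l by (simp add: field_simps)
  then show ?case using x(1) \<xi>1 \<xi>2 by (intro bexI[of _ x]) auto
qed

text \<open>A constant of Landau-Kolmogorov type: the 1 bounds the derivative of order
  \<open>k\<close>, and each summand is the value at a good point that is added on passing to the
  next lower order.\<close>

definition derivative_bound :: "nat \<Rightarrow> real" where
  "derivative_bound k = 1 + (\<Sum>i<k. landau_const i 1)"

lemma derivative_bound_ge_1: "1 \<le> derivative_bound k"
  by (simp add: derivative_bound_def sum_nonneg landau_const_nonneg)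

text \<open>Downward induction from order \<open>k\<close>: starting from a point where the
  derivative of order \<open>n\<close> is small, it changes across the unit interval by at most the
  bound already known for order \<open>n + 1\<close>.\<close>

lemma intermediate_derivative_le:
  fixes u :: "nat \<Rightarrow> real \<Rightarrow> real"
  assumes deriv: "\<And>i x. i < k \<Longrightarrow> x \<in> {0..1} \<Longrightarrow> (u i has_real_derivative u (Suc i) x) (at x within {0..1})"
    and bnd: "\<And>x. x \<in> {0..1} \<Longrightarrow> \<bar>u 0 x\<bar> \<le> 1" "\<And>x. x \<in> {0..1} \<Longrightarrow> \<bar>u k x\<bar> \<le> 1"
    and "j \<le> k" "x \<in> {0..1}"
  shows "\<bar>u j x\<bar> \<le> derivative_bound k"
proof -
  have "\<forall>x\<in>{0..1}. \<bar>u j x\<bar> \<le> 1 + (\<Sum>i=j..<k. landau_const i 1)"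
    using \<open>j \<le> k\<close>
  proof (induction rule: inc_induct)
    case base
    then show ?case using bnd(2) by auto
  next
    case (step n)
    define B where "B = 1 + (\<Sum>i=Suc n..<k. landau_const i 1)"
    obtain \<xi> where \<xi>: "\<xi> \<in> {0..1}" "\<bar>u n \<xi>\<bar> \<le> landau_const n 1"
      using exists_small_derivative[of n u 0 1] deriv bnd(1) step by auto
    have B: "(\<Sum>i=n..<k. landau_const i 1) + 1 = landau_const n 1 + B"
      using step by (simp add: B_def sum.atLeast_Suc_lessThan)
    show ?case
    proof
      fix x :: real assume x: "x \<in> {0..1}"
      have "norm (u n x - u n \<xi>) \<le> B * norm (x - \<xi>)"
        using deriv step x \<xi> by (intro field_differentiable_bound[of "{0..1}"]) (auto simp: B_def)
      also have "\<dots> \<le> B * 1"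
        using x \<xi> by (intro mult_left_mono) (auto simp: B_def sum_nonneg landau_const_nonneg)
      finally show "\<bar>u n x\<bar> \<le> 1 + (\<Sum>i=n..<k. landau_const i 1)"
        using \<xi> B by simp
    qed
  qed
  moreover have "(\<Sum>i=j..<k. landau_const i 1) \<le> (\<Sum>i<k. landau_const i 1)"
    by (intro sum_mono2) (auto simp: landau_const_nonneg)
  ultimately show ?thesis using \<open>x \<in> {0..1}\<close> by (force simp: derivative_bound_def)
qed

section \<open>Iterated partial derivatives of functions in \<open>smooth_class\<close>\<close>

lemma has_real_derivative_partial_x:
  assumes "f differentiable_on unit_square" "x \<in> {0..1}" "y \<in> {0..1}"
  shows "((\<lambda>t. f (t, y)) has_real_derivative partial_x f (x, y)) (at x within {0..1})"
proof -
  have "f differentiable (at (x, y) within unit_square)"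
    using assms unfolding differentiable_on_def by blast
  then have "f differentiable (at (x, y) within (\<lambda>t. (t, y)) ` {0..1})"
    by (rule differentiable_within_subset) (use assms in auto)
  moreover have "((\<lambda>t. (t, y)) has_derivative (\<lambda>t. (t, 0))) (at x within {0..1})"
    by (intro has_derivative_Pair has_derivative_ident has_derivative_const)
  then have "(\<lambda>t. (t, y)) differentiable (at x within {0..1})"
    unfolding differentiable_def by blast
  ultimately have "(\<lambda>t. f (t, y)) differentiable (at x within {0..1})"
    using differentiable_chain_within[of "\<lambda>t. (t, y)" x "{0..1}" f] by (simp add: o_def)
  \<comment> \<open>\<open>vector_derivative\<close> is a choice operator; it denotes the derivative
    once differentiability along the horizontal segment is established.\<close>
  then show ?thesis
    by (simp add: partial_x_def vector_derivative_works has_real_derivative_iff_has_vector_derivative)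
qed

lemma has_real_derivative_partial_y:
  assumes "f differentiable_on unit_square" "x \<in> {0..1}" "y \<in> {0..1}"
  shows "((\<lambda>t. f (x, t)) has_real_derivative partial_y f (x, y)) (at y within {0..1})"
proof -
  have "f differentiable (at (x, y) within unit_square)"
    using assms unfolding differentiable_on_def by blast
  then have "f differentiable (at (x, y) within (\<lambda>t. (x, t)) ` {0..1})"
    by (rule differentiable_within_subset) (use assms in auto)
  moreover have "((\<lambda>t. (x, t)) has_derivative (\<lambda>t. (0, t))) (at y within {0..1})"
    by (intro has_derivative_Pair has_derivative_ident has_derivative_const)
  then have "(\<lambda>t. (x, t)) differentiable (at y within {0..1})"
    unfolding differentiable_def by blast
  ultimately have "(\<lambda>t. f (x, t)) differentiable (at y within {0..1})"
    using differentiable_chain_within[of "\<lambda>t. (x, t)" y "{0..1}" f] by (simp add: o_def)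
  then show ?thesis
    by (simp add: partial_y_def vector_derivative_works has_real_derivative_iff_has_vector_derivative)
qed

lemma times_differentiable_funpow_partial:
  assumes "times_differentiable k f" "i \<le> k"
  shows "times_differentiable (k - i) ((partial_x ^^ i) f) \<and> times_differentiable (k - i) ((partial_y ^^ i) f)"
  using assms(2)
proof (induction i)
  case (Suc i)
  then have "k - i = Suc (k - Suc i)" by simp
  with Suc show ?case by auto
qed (use assms in auto)

lemma differentiable_on_funpow_partial:
  assumes "times_differentiable k f" "i < k"
  shows "(partial_x ^^ i) f differentiable_on unit_square" "(partial_y ^^ i) f differentiable_on unit_square"
proof -
  have "k - i = Suc (k - Suc i)" using assms(2) by simp
  then show "(partial_x ^^ i) f differentiable_on unit_square" "(partial_y ^^ i) f differentiable_on unit_square"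
    using times_differentiable_funpow_partial[OF assms(1), of i] assms(2) by auto
qed

text \<open>On a horizontal line the iterated partial derivatives form a chain bounded by 1 at
  orders 0 and \<open>k\<close>, so the one-dimensional estimate covers the orders between.\<close>

lemma smooth_class_funpow_partial_x:
  assumes f: "f \<in> smooth_class k" and xy: "x \<in> {0..1}" "y \<in> {0..1}"
  shows "i < k \<Longrightarrow> ((\<lambda>t. (partial_x ^^ i) f (t, y)) has_real_derivative (partial_x ^^ Suc i) f (x, y)) (at x within {0..1})"
    and "\<bar>(partial_x ^^ k) f (x, y)\<bar> \<le> 1"
    and "i \<le> k \<Longrightarrow> \<bar>(partial_x ^^ i) f (x, y)\<bar> \<le> derivative_bound k"
proof -
  have deriv: "((\<lambda>t. (partial_x ^^ i) f (t, y)) has_real_derivative (partial_x ^^ Suc i) f (x, y)) (at x within {0..1})"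
    if "i < k" "x \<in> {0..1}" for i x
    using has_real_derivative_partial_x[OF differentiable_on_funpow_partial(1)[of k f i] that(2) xy(2)] f that
    by (simp add: smooth_class_def)
  have "\<forall>z\<in>unit_square. (partial_x ^^ k) ((partial_y ^^ (k - k)) f) z \<in> {-1..1}"
    using f unfolding smooth_class_def by blast
  then have bnd: "\<bar>(partial_x ^^ k) f (x, y)\<bar> \<le> 1" if "x \<in> {0..1}" for x
    using that xy by (force simp: abs_le_iff)
  have bnd0: "\<bar>f (x, y)\<bar> \<le> 1" if "x \<in> {0..1}" for x
    using that xy f by (force simp: abs_le_iff smooth_class_def)
  show "i < k \<Longrightarrow> ((\<lambda>t. (partial_x ^^ i) f (t, y)) has_real_derivative (partial_x ^^ Suc i) f (x, y)) (at x within {0..1})"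
    "\<bar>(partial_x ^^ k) f (x, y)\<bar> \<le> 1"
    using deriv bnd xy by auto
  show "\<bar>(partial_x ^^ i) f (x, y)\<bar> \<le> derivative_bound k" if "i \<le> k"
    using intermediate_derivative_le[of k "\<lambda>i x. (partial_x ^^ i) f (x, y)" i x] deriv bnd bnd0 xy that by simp
qed

text \<open>The Taylor expansion runs in \<open>x\<close> alone. In \<open>y\<close> the bound
  serves to make \<open>f\<close> Lipschitz, so order 1 is enough.\<close>

lemma smooth_class_partial_y_le:
  assumes f: "f \<in> smooth_class k" and k: "1 \<le> k" and xy: "x \<in> {0..1}" "y \<in> {0..1}"
  shows "\<bar>partial_y f (x, y)\<bar> \<le> derivative_bound k"
proof -
  have deriv: "((\<lambda>t. (partial_y ^^ i) f (x, t)) has_real_derivative (partial_y ^^ Suc i) f (x, y)) (at y within {0..1})"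
    if "i < k" "y \<in> {0..1}" for i y
    using has_real_derivative_partial_y[OF differentiable_on_funpow_partial(2)[of k f i] xy(1) that(2)] f that
    by (simp add: smooth_class_def)
  have "\<forall>z\<in>unit_square. (partial_x ^^ 0) ((partial_y ^^ (k - 0)) f) z \<in> {-1..1}"
    using f unfolding smooth_class_def by blast
  then have bnd: "\<bar>(partial_y ^^ k) f (x, y)\<bar> \<le> 1" if "y \<in> {0..1}" for y
    using that xy by (force simp: abs_le_iff)
  have bnd0: "\<bar>f (x, y)\<bar> \<le> 1" if "y \<in> {0..1}" for y
    using that xy f by (force simp: abs_le_iff smooth_class_def)
  show ?thesis
    using intermediate_derivative_le[of k "\<lambda>i y. (partial_y ^^ i) f (x, y)" 1 y] deriv bnd bnd0 xy k by simp
qed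

lemma smooth_class_lipschitz:
  assumes f: "f \<in> smooth_class k" and k: "1 \<le> k"
  shows "x \<in> {0..1} \<Longrightarrow> (derivative_bound k)-lipschitz_on {0..1} (\<lambda>y. f (x, y))"
    and "y \<in> {0..1} \<Longrightarrow> (derivative_bound k)-lipschitz_on {0..1} (\<lambda>x. f (x, y))"
proof -
  have D: "0 \<le> derivative_bound k" using derivative_bound_ge_1[of k] by linarith
  have diff: "f differentiable_on unit_square"
    using differentiable_on_funpow_partial(1)[of k f 0] f k by (simp add: smooth_class_def)
  show "(derivative_bound k)-lipschitz_on {0..1} (\<lambda>y. f (x, y))" if x: "x \<in> {0..1}"
    using field_differentiable_bound[OF convex_real_interval(5) has_real_derivative_partial_y[OF diff x]
        , of "derivative_bound k"] smooth_class_partial_y_le[OF f k x] D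
    by (intro lipschitz_onI) (auto simp: dist_norm)
  show "(derivative_bound k)-lipschitz_on {0..1} (\<lambda>x. f (x, y))" if y: "y \<in> {0..1}"
    using field_differentiable_bound[OF convex_real_interval(5) has_real_derivative_partial_x[OF diff _ y]
        , of "derivative_bound k"] smooth_class_funpow_partial_x(3)[OF f _ y, of _ 1] k D
    by (intro lipschitz_onI) (auto simp: dist_norm)
qed

section \<open>Quantization\<close>

lemma grid_point_le:
  assumes "0 < N" "x \<in> {0..1::real}"
  shows "nat \<lfloor>real N * x\<rfloor> \<le> N" "0 \<le> x - real (nat \<lfloor>real N * x\<rfloor>) / N" "x - real (nat \<lfloor>real N * x\<rfloor>) / N \<le> 1 / N"
proof -
  define a where "a = nat \<lfloor>real N * x\<rfloor>"
  have "real N * x \<le> real N * 1" using assms by (intro mult_left_mono) auto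
  moreover have "0 \<le> real N * x" using assms by auto
  ultimately have "real a \<le> N * x" "N * x < real a + 1" "a \<le> N"
    unfolding a_def by linarith+
  then show "nat \<lfloor>real N * x\<rfloor> \<le> N" "0 \<le> x - real (nat \<lfloor>real N * x\<rfloor>) / N" "x - real (nat \<lfloor>real N * x\<rfloor>) / N \<le> 1 / N"
    using assms(1) unfolding a_def[symmetric]
    by (simp_all add: pos_divide_le_eq pos_le_divide_eq diff_le_eq mult.commute flip: add_divide_distrib)
qed

lemma sum_list_upt_Suc:
  fixes g :: "nat \<Rightarrow> 'a::comm_monoid_add"
  shows "(\<Sum>a\<leftarrow>[0..<Suc N]. g a) = (\<Sum>a\<le>N. g a)"
  by (simp add: sum_list_distinct_conv_sum_set atLeast0LessThan lessThan_Suc_atMost del: upt_Suc)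

lemma sum_list_concat_replicate:
  fixes g :: "'a \<Rightarrow> real"
  shows "(\<Sum>b\<leftarrow>concat (map (\<lambda>a. replicate (n a) a) as). g b) = (\<Sum>a\<leftarrow>as. real (n a) * g a)"
  by (induction as) (simp_all add: sum_list_replicate)

text \<open>Sampling becomes a table lookup \<open>x u\<close> at a uniform slot \<open>u\<close>,
  so the law of the seed is independent of the input. Moving mass to the grid costs L / N, and
  rounding the cell masses to multiples of 1 / K costs the rest. The table is fixed before \<phi>,
  so it serves all test functions at once.\<close>

lemma exists_quantization:
  assumes p: "p \<in> unit_distributions" and NK: "0 < N" "0 < K"
  shows "\<exists>x::nat \<Rightarrow> nat. (\<forall>u. x u \<le> N) \<and> (\<forall>\<phi> L. (\<forall>t\<in>{0..1}. \<bar>\<phi> t\<bar> \<le> 1) \<longrightarrow> L-lipschitz_on {0..1} \<phi> \<longrightarrow>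
     \<bar>integral\<^sup>L p \<phi> - measure_pmf.expectation (pmf_of_set {..<K}) (\<lambda>u. \<phi> (real (x u) / N))\<bar>
       \<le> L / N + 2 * (real N + 1) / K)"
proof -
  interpret prob_space p using p by (simp add: unit_distributions_def space_prob_algebra)
  have sets: "sets p = sets (restrict_space borel {0..1})"
    using p by (simp add: unit_distributions_def space_prob_algebra)
  have space: "space p = {0..1}" using sets_eq_imp_space_eq[OF sets] by (simp add: space_restrict_space)
  define A where "A = (\<lambda>a. {x \<in> {0..1::real}. nat \<lfloor>real N * x\<rfloor> = a})"
  have A_eq: "A a = {0..1} \<inter> (\<lambda>x::real. nat \<lfloor>real N * x\<rfloor>) -` {a}" for a
    by (auto simp: A_def)
  have meas_fl: "(\<lambda>x::real. nat \<lfloor>real N * x\<rfloor>) \<in> borel \<rightarrow>\<^sub>M count_space UNIV"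
    by measurable
  have A [measurable]: "A a \<in> sets p" for a
    using measurable_sets[OF meas_fl, of "{a}"] unfolding sets A_eq sets_restrict_space
    by (intro image_eqI[OF refl]) auto
  define w where "w = (\<lambda>a. prob (A a))"
  have disj: "disjoint_family_on A {..N}" by (auto simp: disjoint_family_on_def A_def)
  have "(\<Union>a\<le>N. A a) = space p" using grid_point_le(1)[OF NK(1)] by (auto simp: A_def space)
  then have w1: "(\<Sum>a\<le>N. w a) = 1"
    unfolding w_def using finite_measure_finite_Union[OF _ _ disj] prob_space A by (simp add: image_subset_iff)
  define n where "n = (\<lambda>a. nat \<lfloor>K * w a\<rfloor>)"
  have n: "real (n a) \<le> K * w a" "K * w a \<le> real (n a) + 1" for a
  proof -
    have "0 \<le> K * w a" by (simp add: w_def)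
    then show "real (n a) \<le> K * w a" "K * w a \<le> real (n a) + 1" unfolding n_def by linarith+
  qed
  have "real (\<Sum>a\<le>N. n a) \<le> (\<Sum>a\<le>N. K * w a)" unfolding of_nat_sum by (intro sum_mono n)
  also have "\<dots> = K" using w1 by (simp flip: sum_distrib_left)
  finally have nK: "(\<Sum>a\<le>N. n a) \<le> K" by (simp only: of_nat_le_iff)
  define R where "R = K - (\<Sum>a\<le>N. n a)"
  have R: "real R = (\<Sum>a\<le>N. K * w a - n a)"
    using w1 nK by (simp add: R_def of_nat_diff sum_subtractf flip: sum_distrib_left)
  also have "\<dots> \<le> (\<Sum>a\<le>N. 1)" using n by (intro sum_mono) (simp add: algebra_simps)
  finally have RN: "real R \<le> real N + 1" by simp
  \<comment> \<open>The \<open>R\<close> slots lost to rounding down are filled arbitrarily, with \<open>0\<close>.\<close>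
  define xs where "xs = concat (map (\<lambda>a. replicate (n a) a) [0..<Suc N]) @ replicate R 0"
  have len: "length xs = K"
    unfolding xs_def length_append length_concat map_map o_def length_replicate sum_list_upt_Suc
    using nK by (simp add: R_def)
  have sl: "(\<Sum>a\<leftarrow>xs. g a) = (\<Sum>a\<le>N. n a * g a) + R * g 0" for g :: "nat \<Rightarrow> real"
    unfolding xs_def map_append sum_list_append sum_list_concat_replicate sum_list_upt_Suc
    by (simp add: sum_list_replicate)
  \<comment> \<open>The default 0 keeps \<open>x u\<close> a grid index for slots outside the table
    as well.\<close>
  define x where "x = (\<lambda>u. if u < K then xs ! u else 0)"
  have "set xs \<subseteq> {..N}" by (auto simp: xs_def split: if_splits simp del: upt_Suc)
  then have xN: "x u \<le> N" for u using nth_mem[of u xs] len by (force simp: x_def)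
  have avg: "measure_pmf.expectation (pmf_of_set {..<K}) (\<lambda>u. g (x u))
      = ((\<Sum>a\<le>N. n a * g a) + R * g 0) / K" for g :: "nat \<Rightarrow> real"
  proof -
    have "(\<Sum>u<K. g (x u)) = (\<Sum>a\<leftarrow>xs. g a)"
      by (simp add: sum_list_sum_nth len x_def atLeast0LessThan)
    then show ?thesis using NK by (subst integral_pmf_of_set) (auto simp: sl)
  qed
  show ?thesis
  proof (intro exI[of _ x] conjI allI impI xN)
    fix \<phi> :: "real \<Rightarrow> real" and L :: real
    assume \<phi>: "\<forall>t\<in>{0..1}. \<bar>\<phi> t\<bar> \<le> 1" and L: "L-lipschitz_on {0..1} \<phi>"
    have "\<phi> \<in> borel_measurable (restrict_space borel {0..1})"
      using lipschitz_on_continuous_on[OF L] by (rule borel_measurable_continuous_on_restrict)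
    then have [measurable]: "\<phi> \<in> borel_measurable p" using measurable_cong_sets[OF sets refl] by blast
    have int\<phi>: "integrable p \<phi>"
      using \<phi> by (intro integrable_const_bound[where B = 1]) (auto simp: space)
    \<comment> \<open>\<psi> evaluates \<phi> at the argument rounded down to the grid, which turns
      its integral into a finite sum weighted by the cell masses.\<close>
    define \<psi> where "\<psi> = (\<lambda>t. \<Sum>a\<le>N. \<phi> (real a / N) * indicator (A a) t)"
    have int\<psi>: "integrable p \<psi>" unfolding \<psi>_def
      by (intro Bochner_Integration.integrable_sum integrable_mult_right integrable_real_indicator) (auto simp: emeasure_eq_measure)
    have I\<psi>: "integral\<^sup>L p \<psi> = (\<Sum>a\<le>N. \<phi> (real a / N) * w a)" unfolding \<psi>_def
      by (subst Bochner_Integration.integral_sum) (auto simp: w_def emeasure_eq_measure)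
    have \<psi>: "\<psi> t = \<phi> (real (nat \<lfloor>real N * t\<rfloor>) / N)" if "t \<in> {0..1}" for t
    proof -
      have "\<psi> t = (\<Sum>a\<le>N. if nat \<lfloor>real N * t\<rfloor> = a then \<phi> (real a / N) else 0)"
        unfolding \<psi>_def using that by (intro sum.cong) (auto simp: A_def indicator_def)
      then show ?thesis using grid_point_le(1)[OF NK(1) that] by simp
    qed
    have close: "\<bar>\<phi> t - \<psi> t\<bar> \<le> L / N" if "t \<in> {0..1}" for t
    proof -
      define g where "g = real (nat \<lfloor>real N * t\<rfloor>) / N"
      have g: "0 \<le> t - g" "t - g \<le> 1 / N" "g \<in> {0..1}"
        using grid_point_le[OF NK(1) that] that NK by (auto simp: g_def field_simps)
      have "\<bar>\<phi> t - \<psi> t\<bar> \<le> L * \<bar>t - g\<bar>"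
        using lipschitz_onD[OF L that g(3)] \<psi>[OF that] by (simp add: g_def dist_real_def)
      also have "\<dots> \<le> L * (1 / N)" using g lipschitz_on_nonneg[OF L] by (intro mult_left_mono) auto
      finally show ?thesis by simp
    qed
    have "\<bar>integral\<^sup>L p \<phi> - integral\<^sup>L p \<psi>\<bar> = \<bar>\<integral>t. \<phi> t - \<psi> t \<partial>p\<bar>"
      using int\<phi> int\<psi> by simp
    also have "\<dots> \<le> (\<integral>t. \<bar>\<phi> t - \<psi> t\<bar> \<partial>p)" using integral_norm_bound[of p "\<lambda>t. \<phi> t - \<psi> t"] by simp
    also have "\<dots> \<le> (\<integral>t. L / N \<partial>p)"
      using int\<phi> int\<psi> close by (intro integral_mono) (auto simp: space)
    finally have 1: "\<bar>integral\<^sup>L p \<phi> - integral\<^sup>L p \<psi>\<bar> \<le> L / N" by (simp add: prob_space)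
    define e where "e = measure_pmf.expectation (pmf_of_set {..<K}) (\<lambda>u. \<phi> (real (x u) / N))"
    have "K * e = (\<Sum>a\<le>N. n a * \<phi> (real a / N)) + R * \<phi> 0"
      using NK avg[of "\<lambda>a. \<phi> (real a / N)"] by (simp add: e_def)
    then have "K * (integral\<^sup>L p \<psi> - e) = (\<Sum>a\<le>N. (K * w a - n a) * \<phi> (real a / N)) - R * \<phi> 0"
      by (simp add: I\<psi> right_diff_distrib left_diff_distrib sum_subtractf sum_distrib_left mult_ac)
    also have "\<bar>\<dots>\<bar> \<le> \<bar>\<Sum>a\<le>N. (K * w a - n a) * \<phi> (real a / N)\<bar> + \<bar>R * \<phi> 0\<bar>" by linarith
    \<comment> \<open>The deficit \<open>R\<close> is counted twice, once as mass lost to rounding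
      and once as mass placed at 0; \<open>R\<close> is at most N + 1.\<close>
    also have "\<dots> \<le> (\<Sum>a\<le>N. K * w a - n a) + R"
    proof (intro add_mono order_trans[OF sum_abs sum_mono])
      fix a assume "a \<in> {..N}"
      then have "\<bar>\<phi> (real a / N)\<bar> \<le> 1" using \<phi> NK by auto
      then have "\<bar>K * w a - n a\<bar> * \<bar>\<phi> (real a / N)\<bar> \<le> \<bar>K * w a - n a\<bar> * 1" by (intro mult_left_mono) auto
      then show "\<bar>(K * w a - n a) * \<phi> (real a / N)\<bar> \<le> K * w a - n a" using n(1)[of a] by (simp add: abs_mult)
    next
      show "\<bar>R * \<phi> 0\<bar> \<le> R" using mult_left_mono[of "\<bar>\<phi> 0\<bar>" 1 "real R"] \<phi> by (simp add: abs_mult)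
    qed
    also have "\<dots> \<le> 2 * (real N + 1)" using R RN by simp
    finally have "\<bar>integral\<^sup>L p \<psi> - e\<bar> \<le> 2 * (real N + 1) / K" using NK by (simp add: abs_mult pos_le_divide_eq mult.commute)
    with 1 show "\<bar>integral\<^sup>L p \<phi> - measure_pmf.expectation (pmf_of_set {..<K}) (\<lambda>u. \<phi> (real (x u) / N))\<bar>
       \<le> L / N + 2 * (real N + 1) / K" unfolding e_def by linarith
  qed
qed

text \<open>The marginals are replaced one at a time, each at cost \<tau>: first \<open>q\<close>
  for every fixed first coordinate, then \<open>p\<close> at the sampled second coordinates.\<close>

lemma integral_pair_quantized:
  fixes f :: "real \<times> real \<Rightarrow> real" and x :: "'a \<Rightarrow> real" and y :: "'b \<Rightarrow> real"
  assumes p: "p \<in> unit_distributions" and q: "q \<in> unit_distributions"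
    and cont: "continuous_on unit_square f" and f1: "\<And>z. z \<in> unit_square \<Longrightarrow> \<bar>f z\<bar> \<le> 1"
    and fin: "finite (set_pmf U)" "finite (set_pmf V)"
    and xy: "\<And>u. x u \<in> {0..1}" "\<And>v. y v \<in> {0..1}"
    and px: "\<And>b. b \<in> {0..1} \<Longrightarrow> \<bar>(\<integral>a. f (a, b) \<partial>p) - measure_pmf.expectation U (\<lambda>u. f (x u, b))\<bar> \<le> \<tau>"
    and qy: "\<And>a. a \<in> {0..1} \<Longrightarrow> \<bar>(\<integral>b. f (a, b) \<partial>q) - measure_pmf.expectation V (\<lambda>v. f (a, y v))\<bar> \<le> \<tau>"
  shows "\<bar>integral\<^sup>L (p \<Otimes>\<^sub>M q) f
    - measure_pmf.expectation U (\<lambda>u. measure_pmf.expectation V (\<lambda>v. f (x u, y v)))\<bar> \<le> 2 * \<tau>"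
proof -
  interpret P: prob_space p using p by (simp add: unit_distributions_def space_prob_algebra)
  interpret Q: prob_space q using q by (simp add: unit_distributions_def space_prob_algebra)
  interpret PQ: pair_prob_space p q ..
  have sets: "sets p = sets (restrict_space borel {0..1})" "sets q = sets (restrict_space borel {0..1})"
    using p q by (simp_all add: unit_distributions_def space_prob_algebra)
  have space: "space p = {0..1}" "space q = {0..1}"
    using sets[THEN sets_eq_imp_space_eq] by (simp_all add: space_restrict_space)
  have id: "(\<lambda>a. a) \<in> p \<rightarrow>\<^sub>M borel" "(\<lambda>a. a) \<in> q \<rightarrow>\<^sub>M borel"
    using measurable_restrict_space1[of "\<lambda>a. a" borel borel "{0..1::real}"] sets
    by (simp_all cong: measurable_cong_sets)
  have "(\<lambda>z. (fst z, snd z)) \<in> p \<Otimes>\<^sub>M q \<rightarrow>\<^sub>M borel \<Otimes>\<^sub>M borel"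
    by (intro measurable_Pair measurable_compose[OF measurable_fst id(1)] measurable_compose[OF measurable_snd id(2)])
  \<comment> \<open>Continuity of \<open>f\<close> is known on the square only, so measurability is
    obtained through the Borel space restricted to it.\<close>
  then have "(\<lambda>z. z) \<in> p \<Otimes>\<^sub>M q \<rightarrow>\<^sub>M restrict_space borel unit_square"
    by (intro measurable_restrict_space2) (auto simp: space_pair_measure space borel_prod)
  from measurable_compose[OF this borel_measurable_continuous_on_restrict[OF cont]]
  have f_meas [measurable]: "f \<in> borel_measurable (p \<Otimes>\<^sub>M q)" by simp
  have int_f: "integrable (p \<Otimes>\<^sub>M q) f"
    using f1 by (intro PQ.P.integrable_const_bound[where B = 1]) (auto simp: space_pair_measure space)
  have int_p: "integrable p (\<lambda>a. f (a, b))" if "b \<in> {0..1}" for b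
  proof (rule P.integrable_const_bound[where B = 1])
    show "AE a in p. norm (f (a, b)) \<le> 1" using f1 that by (auto simp: space)
    show "(\<lambda>a. f (a, b)) \<in> borel_measurable p"
      using measurable_compose[OF measurable_Pair2'[of b q p] f_meas] that by (simp add: space)
  qed
  have E_sum: "measure_pmf.expectation V h = (\<Sum>v\<in>set_pmf V. pmf V v * h v)" for h :: "'b \<Rightarrow> real"
    using fin by (subst integral_measure_pmf[of "set_pmf V"]) auto
  have int_E: "integrable p (\<lambda>a. measure_pmf.expectation V (\<lambda>v. f (a, y v)))"
    unfolding E_sum using xy by (intro Bochner_Integration.integrable_sum integrable_mult_right int_p) auto
  have swap: "(\<integral>a. measure_pmf.expectation V (\<lambda>v. f (a, y v)) \<partial>p)
      = measure_pmf.expectation V (\<lambda>v. \<integral>a. f (a, y v) \<partial>p)"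
    unfolding E_sum using xy int_p by (subst Bochner_Integration.integral_sum) auto
  have int_q: "integrable p (\<lambda>a. \<integral>b. f (a, b) \<partial>q)" by (rule PQ.integrable_fst'[OF int_f])
  have "integral\<^sup>L (p \<Otimes>\<^sub>M q) f - (\<integral>a. measure_pmf.expectation V (\<lambda>v. f (a, y v)) \<partial>p)
      = (\<integral>a. (\<integral>b. f (a, b) \<partial>q) - measure_pmf.expectation V (\<lambda>v. f (a, y v)) \<partial>p)"
    using int_q int_E PQ.integral_fst'[OF int_f] by simp
  also have "\<bar>\<dots>\<bar> \<le> (\<integral>a. \<bar>(\<integral>b. f (a, b) \<partial>q) - measure_pmf.expectation V (\<lambda>v. f (a, y v))\<bar> \<partial>p)"
    using integral_norm_bound[of p "\<lambda>a. (\<integral>b. f (a, b) \<partial>q) - measure_pmf.expectation V (\<lambda>v. f (a, y v))"]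
    by simp
  also have "\<dots> \<le> (\<integral>a. \<tau> \<partial>p)"
    using int_q int_E qy by (intro integral_mono) (auto simp: space)
  finally have 1: "\<bar>integral\<^sup>L (p \<Otimes>\<^sub>M q) f - measure_pmf.expectation V (\<lambda>v. \<integral>a. f (a, y v) \<partial>p)\<bar> \<le> \<tau>"
    by (simp add: P.prob_space swap)
  have "measure_pmf.expectation V (\<lambda>v. \<integral>a. f (a, y v) \<partial>p)
      - measure_pmf.expectation V (\<lambda>v. measure_pmf.expectation U (\<lambda>u. f (x u, y v)))
    = measure_pmf.expectation V (\<lambda>v. (\<integral>a. f (a, y v) \<partial>p) - measure_pmf.expectation U (\<lambda>u. f (x u, y v)))"
    using fin by (simp add: integrable_measure_pmf_finite)
  also have "\<bar>\<dots>\<bar> \<le> \<tau>" using fin px xy by (intro abs_expectation_le) auto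
  finally have "\<bar>measure_pmf.expectation V (\<lambda>v. \<integral>a. f (a, y v) \<partial>p)
      - measure_pmf.expectation U (\<lambda>u. measure_pmf.expectation V (\<lambda>v. f (x u, y v)))\<bar> \<le> \<tau>"
    using expectation_swap_finite[OF fin, of "\<lambda>u v. f (x u, y v)"] by simp
  with 1 show ?thesis by linarith
qed

section \<open>The protocol for a low-rank approximation\<close>

lemma floor_divide_in_range:
  fixes r \<delta> B :: real
  assumes "0 < \<delta>" "\<bar>r\<bar> \<le> B" "B / \<delta> + 1 \<le> real Z"
  shows "\<lfloor>r / \<delta>\<rfloor> \<in> {- int Z..int Z}"
proof -
  have "\<bar>r / \<delta>\<bar> \<le> B / \<delta>" using assms by (simp add: abs_divide divide_right_mono)
  then have "\<bar>r / \<delta>\<bar> \<le> real Z - 1" using assms by linarith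
  then show ?thesis unfolding atLeastAtMost_iff by linarith
qed

lemma floor_divide_error:
  fixes r \<delta> :: real
  assumes "0 < \<delta>"
  shows "\<bar>\<delta> * \<lfloor>r / \<delta>\<rfloor> - r\<bar> \<le> \<delta>"
proof -
  have "\<delta> * \<lfloor>r / \<delta>\<rfloor> \<le> \<delta> * (r / \<delta>)" "\<delta> * (r / \<delta>) \<le> \<delta> * (\<lfloor>r / \<delta>\<rfloor> + 1)"
    using assms by (intro mult_left_mono; linarith)+
  then show ?thesis using assms by (simp add: algebra_simps)
qed

text \<open>Alice sends \<open>s\<close> sample indices and \<open>T\<close> rounded moments, Bob
  \<open>s\<close> indices and one number, Alice one more number; every symbol takes
  \<open>b\<close> bits. The error budget is \<epsilon>/4 for sampling, \<epsilon>/2 for rounding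
  messages and \<epsilon>/4 for quantizing the two inputs.\<close>

lemma rand_comm_le_low_rank:
  fixes f :: "real \<times> real \<Rightarrow> real" and \<phi> \<psi> :: "nat \<Rightarrow> real \<Rightarrow> real" and L D \<eta> \<epsilon> \<delta> :: real
  assumes cont: "continuous_on unit_square f" and f1: "\<And>z. z \<in> unit_square \<Longrightarrow> \<bar>f z\<bar> \<le> 1"
    and lip: "\<And>y. y \<in> {0..1} \<Longrightarrow> L-lipschitz_on {0..1} (\<lambda>x. f (x, y))"
      "\<And>x. x \<in> {0..1} \<Longrightarrow> L-lipschitz_on {0..1} (\<lambda>y. f (x, y))"
    and \<phi>: "\<And>t x. t < T \<Longrightarrow> x \<in> {0..1} \<Longrightarrow> \<phi> t x \<in> {0..1}"
    and \<psi>: "\<And>t y. t < T \<Longrightarrow> y \<in> {0..1} \<Longrightarrow> \<bar>\<psi> t y\<bar> \<le> D"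
    and approx: "\<And>x y. x \<in> {0..1} \<Longrightarrow> y \<in> {0..1} \<Longrightarrow> \<bar>f (x, y) - (\<Sum>t<T. \<phi> t x * \<psi> t y)\<bar> \<le> \<eta>"
    and \<eta>: "\<eta> \<le> 1" "28 * \<eta> \<le> \<epsilon> * real s" and \<epsilon>: "0 < \<epsilon>" and s: "0 < s" and D: "1 \<le> D"
    and N: "0 < N" "16 * L \<le> \<epsilon> * real N"
    and \<delta>: "0 < \<delta>" "\<delta> * (real T * D + 2) \<le> \<epsilon> / 2"
    and Z: "N \<le> Z" "(real T * D + 2) / \<delta> + 1 \<le> real Z" "2 * Z + 1 \<le> 2 ^ b"
  shows "rand_comm \<epsilon> f \<le> enat (b * (2 * s + T + 2))"
proof -
  \<comment> \<open>This size makes the slot error 2 (N + 1) / K at most \<epsilon>/16, equal to the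
    allowance for the mesh error L / N.\<close>
  define K where "K = nat \<lceil>32 * (real N + 1) / \<epsilon>\<rceil>"
  have K: "32 * (real N + 1) / \<epsilon> \<le> real K" unfolding K_def by linarith
  have "0 < 32 * (real N + 1) / \<epsilon>" using \<epsilon> by simp
  with K have K0: "0 < K" by linarith
  define U where "U = pmf_of_set {..<K}"
  have fin: "finite (set_pmf U)" using K0 by (subst U_def) (auto simp: set_pmf_of_set lessThan_empty_iff)
  note int = integrable_measure_pmf_finite[OF fin]
  have "L / N + 2 * (real N + 1) / K \<le> \<epsilon> / 16 + \<epsilon> / 16"
    using N K K0 \<epsilon> by (intro add_mono) (simp_all add: field_simps)
  then have \<tau>: "L / N + 2 * (real N + 1) / K \<le> \<epsilon> / 8" by simp
  define pt where "pt = (\<lambda>i::nat. real i / N)"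
  have pt: "pt i \<in> {0..1}" if "i \<le> N" for i using that N by (simp add: pt_def)
  have "\<forall>p\<in>unit_distributions. \<exists>x::nat \<Rightarrow> nat. (\<forall>u. x u \<le> N) \<and> (\<forall>h. (\<forall>t\<in>{0..1}. \<bar>h t\<bar> \<le> 1) \<longrightarrow> L-lipschitz_on {0..1} h \<longrightarrow>
     \<bar>integral\<^sup>L p h - measure_pmf.expectation U (\<lambda>u. h (pt (x u)))\<bar> \<le> \<epsilon> / 8)"
    using exists_quantization[OF _ N(1) K0] order_trans[OF _ \<tau>] unfolding U_def pt_def by meson
  \<comment> \<open>The table \<open>X p\<close> depends on the owner's distribution alone, so each
    party can read its own samples off the shared seed.\<close>
  then obtain X :: "real measure \<Rightarrow> nat \<Rightarrow> nat" where
    XN: "\<And>p u. p \<in> unit_distributions \<Longrightarrow> X p u \<le> N" and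
    X: "\<And>p h. p \<in> unit_distributions \<Longrightarrow> \<forall>t\<in>{0..1}. \<bar>h t\<bar> \<le> 1 \<Longrightarrow> L-lipschitz_on {0..1} h \<Longrightarrow>
      \<bar>integral\<^sup>L p h - measure_pmf.expectation U (\<lambda>u. h (pt (X p u)))\<bar> \<le> \<epsilon> / 8"
    by (subst (asm) bchoice_iff) blast
  define h where "h = (\<lambda>i j. f (pt i, pt j) - (\<Sum>t<T. \<phi> t (pt i) * \<psi> t (pt j)))"
  have h: "\<bar>h i j\<bar> \<le> \<eta>" if "i \<le> N" "j \<le> N" for i j
    unfolding h_def using approx pt that by blast
  define \<alpha> where "\<alpha> = (\<lambda>t p. measure_pmf.expectation U (\<lambda>u. \<phi> t (pt (X p u))))"
  define \<beta> where "\<beta> = (\<lambda>t q. measure_pmf.expectation U (\<lambda>v. \<psi> t (pt (X q v))))"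
  \<comment> \<open>Sample indices travel as integers and are decoded by \<open>nat\<close>, so that
    they share the alphabet \<open>I\<close> with the rounded reals.\<close>
  define m1 where "m1 = (\<lambda>(us::nat list, vs::nat list) p. (map (\<lambda>u. int (X p u)) us, map (\<lambda>t. \<lfloor>\<alpha> t p / \<delta>\<rfloor>) [0..<T]))"
  \<comment> \<open>Knowing Alice's samples and rounded moments, Bob evaluates the row term of the
    estimator together with the whole low-rank part and sends the rounded total.\<close>
  define zB where "zB = (\<lambda>(is, ts) q. (\<Sum>i\<leftarrow>is. measure_pmf.expectation U (\<lambda>v. h (nat i) (X q v))) / s
    + (\<Sum>t<T. (\<delta> * real_of_int (ts ! t)) * \<beta> t q))"
  define m2 where "m2 = (\<lambda>(us::nat list, vs::nat list) m q. (map (\<lambda>v. int (X q v)) vs, \<lfloor>zB m q / \<delta>\<rfloor>))"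
  \<comment> \<open>The column term combines Bob's samples with Alice's full distribution, hence a
    third message. The term on sample pairs is known to both parties and is subtracted in
    \<open>out\<close>.\<close>
  define zA where "zA = (\<lambda>js p. (\<Sum>j\<leftarrow>js. measure_pmf.expectation U (\<lambda>u. h (X p u) (nat j))) / s)"
  define m3 where "m3 = (\<lambda>(m::int list \<times> int list) (n::int list \<times> int) p. \<lfloor>zA (fst n) p / \<delta>\<rfloor>)"
  define out where "out = (\<lambda>(m::int list \<times> int list) (n::int list \<times> int) (z::int).
    \<delta> * real_of_int (snd n) + \<delta> * real_of_int z - (\<Sum>i\<leftarrow>fst m. \<Sum>j\<leftarrow>fst n. h (nat i) (nat j)) / (real s)\<^sup>2)"
  define I where "I = {- int Z..int Z}"
  define W where "W = (\<lambda>n. {xs. set xs \<subseteq> I \<and> length xs = n})"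
  have "card I = 2 * Z + 1" unfolding I_def card_atLeastAtMost_int by linarith
  then have cI: "card I \<le> 2 ^ b" using Z(3) by simp
  have cW: "card (W n) \<le> 2 ^ (b * n)" for n
    using power_mono[OF cI, of n] by (simp add: W_def card_lists_length_eq I_def power_mult)
  have fI: "finite I" "finite (W n)" for n by (simp_all add: I_def W_def finite_lists_length_eq)
  have c1: "card (W s \<times> W T) \<le> 2 ^ (b * s + b * T)"
    using mult_mono[OF cW[of s] cW[of T]] by (simp add: card_cartesian_product power_add)
  have c2: "card (W s \<times> I) \<le> 2 ^ (b * s + b)"
    using mult_mono[OF cW[of s] cI] by (simp add: card_cartesian_product power_add)
  have "\<forall>w. \<exists>P. (\<forall>p q. m1 w p \<in> W s \<times> W T \<longrightarrow> m2 w (m1 w p) q \<in> W s \<times> I \<longrightarrow> m3 (m1 w p) (m2 w (m1 w p) q) p \<in> I \<longrightarrow>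
      run P p q = out (m1 w p) (m2 w (m1 w p) q) (m3 (m1 w p) (m2 w (m1 w p) q) p)) \<and>
    (\<forall>p q. bits P p q \<le> (b * s + b * T) + (b * s + b) + b)"
    using fI c1 c2 cI by (intro allI exists_three_round_protocol) auto
  then obtain \<pi> where
    run: "\<And>w p q. m1 w p \<in> W s \<times> W T \<Longrightarrow> m2 w (m1 w p) q \<in> W s \<times> I \<Longrightarrow> m3 (m1 w p) (m2 w (m1 w p) q) p \<in> I \<Longrightarrow>
      run (\<pi> w) p q = out (m1 w p) (m2 w (m1 w p) q) (m3 (m1 w p) (m2 w (m1 w p) q) p)" and
    bits: "\<And>w p q. bits (\<pi> w) p q \<le> (b * s + b * T) + (b * s + b) + b"
    by metis
  show ?thesis
  proof (rule rand_comm_le[where P = "pair_pmf (replicate_pmf s U) (replicate_pmf s U)" and \<pi> = \<pi>])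
    show "bits (\<pi> w) p q \<le> b * (2 * s + T + 2)" for w p q
      using bits[of w p q] by (simp add: algebra_simps)
  next
    fix p q assume p: "p \<in> unit_distributions" and q: "q \<in> unit_distributions"
    define H where "H = (\<lambda>u v. h (X p u) (X q v))"
    define Er where "Er = (\<lambda>u. measure_pmf.expectation U (H u))"
    define Ec where "Ec = (\<lambda>v. measure_pmf.expectation U (\<lambda>u. H u v))"
    have H: "\<bar>H u v\<bar> \<le> \<eta>" for u v using h XN p q by (simp add: H_def)
    have ErEc: "\<bar>Er u\<bar> \<le> \<eta>" "\<bar>Ec v\<bar> \<le> \<eta>" for u v
      unfolding Er_def Ec_def by (intro abs_expectation_le fin H)+
    have \<alpha>: "\<bar>\<alpha> t p\<bar> \<le> 1" if "t < T" for t
      unfolding \<alpha>_def using \<phi>[OF that pt[OF XN[OF p]]] by (intro abs_expectation_le fin) auto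
    have \<beta>: "\<bar>\<beta> t q\<bar> \<le> D" if "t < T" for t
      unfolding \<beta>_def using \<psi>[OF that pt[OF XN[OF q]]] by (intro abs_expectation_le fin) auto
    have TD: "0 \<le> real T * D" using D by simp
    have sum_le: "\<bar>\<Sum>u\<leftarrow>us. c u\<bar> \<le> s" if "length us = s" "\<And>u. \<bar>c u\<bar> \<le> \<eta>" for us :: "nat list" and c :: "nat \<Rightarrow> real"
    proof -
      have "\<bar>\<Sum>u\<leftarrow>us. c u\<bar> \<le> (\<Sum>u\<leftarrow>us. \<bar>c u\<bar>)" using sum_list_abs[of "map c us"] by (simp add: o_def)
      also have "\<dots> \<le> (\<Sum>u\<leftarrow>us. 1)" using that(2) \<eta>(1) by (intro sum_list_mono) (meson order_trans)
      finally show ?thesis using that(1) by (simp add: sum_list_triv)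
    qed
    have est: "\<bar>run (\<pi> (us, vs)) p q - integral\<^sup>L (p \<Otimes>\<^sub>M q) f\<bar> \<le> \<epsilon>"
      if len: "length us = s" "length vs = s" and
        dev: "\<bar>(\<Sum>u\<leftarrow>us. Er u) / s + (\<Sum>v\<leftarrow>vs. Ec v) / s - (\<Sum>u\<leftarrow>us. \<Sum>v\<leftarrow>vs. H u v) / (real s)\<^sup>2
          - measure_pmf.expectation U Er\<bar> \<le> \<epsilon> / 4" for us vs
    proof -
      define w where "w = (us, vs)"
      define \<alpha>' where "\<alpha>' = (\<lambda>t. \<delta> * real_of_int \<lfloor>\<alpha> t p / \<delta>\<rfloor>)"
      define a where "a = (\<Sum>u\<leftarrow>us. Er u) / s + (\<Sum>t<T. \<alpha>' t * \<beta> t q)"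
      define c where "c = (\<Sum>v\<leftarrow>vs. Ec v) / s"
      have zB: "zB (m1 w p) q = a"
        by (simp add: zB_def m1_def w_def a_def \<alpha>'_def o_def Er_def H_def)
      have zA: "zA (fst (m2 w (m1 w p) q)) p = c"
        by (simp add: zA_def m2_def w_def c_def o_def Ec_def H_def)
      have \<alpha>'_err: "\<bar>\<alpha>' t - \<alpha> t p\<bar> \<le> \<delta>" for t
        unfolding \<alpha>'_def by (rule floor_divide_error[OF \<delta>(1)])
      \<comment> \<open>Because \<phi> takes values in [0, 1], rounding down keeps the moment in
        [0, 1].\<close>
      have \<alpha>'_bd: "\<bar>\<alpha>' t\<bar> \<le> 1" if "t < T" for t
      proof -
        have "0 \<le> \<alpha> t p" unfolding \<alpha>_def using \<phi>[OF that pt[OF XN[OF p]]] by (intro Bochner_Integration.integral_nonneg) auto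
        then have "0 \<le> \<lfloor>\<alpha> t p / \<delta>\<rfloor>" using \<delta>(1) by simp
        moreover have "\<alpha>' t \<le> \<delta> * (\<alpha> t p / \<delta>)"
          unfolding \<alpha>'_def using \<delta>(1) by (intro mult_left_mono) auto
        ultimately show ?thesis using \<alpha>[OF that] \<delta>(1) by (simp add: \<alpha>'_def)
      qed
      have "\<bar>\<Sum>t<T. \<alpha>' t * \<beta> t q\<bar> \<le> (\<Sum>t<T. 1 * D)"
        using \<alpha>'_bd \<beta> by (intro order_trans[OF sum_abs sum_mono], unfold abs_mult, intro mult_mono) auto
      then have "\<bar>\<Sum>t<T. \<alpha>' t * \<beta> t q\<bar> \<le> real T * D" by simp
      moreover have "\<bar>(\<Sum>u\<leftarrow>us. Er u) / s\<bar> \<le> 1"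
        using sum_le[OF len(1) ErEc(1)] s by (simp add: abs_divide)
      ultimately have "\<bar>a\<bar> \<le> real T * D + 2" unfolding a_def by linarith
      then have aI: "\<lfloor>a / \<delta>\<rfloor> \<in> I" unfolding I_def by (rule floor_divide_in_range[OF \<delta>(1) _ Z(2)])
      have "\<bar>c\<bar> \<le> 1" unfolding c_def using sum_le[OF len(2) ErEc(2)] s by (simp add: abs_divide)
      then have "\<bar>c\<bar> \<le> real T * D + 2" using TD by linarith
      then have cI: "\<lfloor>c / \<delta>\<rfloor> \<in> I" unfolding I_def by (rule floor_divide_in_range[OF \<delta>(1) _ Z(2)])
      have "\<bar>\<alpha> t p\<bar> \<le> real T * D + 2" if "t < T" for t using \<alpha>[OF that] TD by linarith
      then have \<alpha>I: "\<lfloor>\<alpha> t p / \<delta>\<rfloor> \<in> I" if "t < T" for t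
        unfolding I_def using that by (intro floor_divide_in_range[OF \<delta>(1) _ Z(2)]) auto
      have XI: "int (X p u) \<in> I" "int (X q u) \<in> I" for u
        using XN[OF p, of u] XN[OF q, of u] Z(1) by (auto simp: I_def)
      have "run (\<pi> w) p q = out (m1 w p) (m2 w (m1 w p) q) (m3 (m1 w p) (m2 w (m1 w p) q) p)"
      proof (rule run)
        show "m1 w p \<in> W s \<times> W T" using \<alpha>I XI len by (auto simp: m1_def w_def W_def)
        show "m2 w (m1 w p) q \<in> W s \<times> I" using zB aI XI len by (auto simp: m2_def w_def W_def)
        show "m3 (m1 w p) (m2 w (m1 w p) q) p \<in> I" using zA cI by (simp add: m3_def)
      qed
      also have "\<dots> = \<delta> * \<lfloor>a / \<delta>\<rfloor> + \<delta> * \<lfloor>c / \<delta>\<rfloor> - (\<Sum>u\<leftarrow>us. \<Sum>v\<leftarrow>vs. H u v) / (real s)\<^sup>2"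
        using zA zB by (simp add: out_def m3_def) (simp add: m1_def m2_def w_def o_def H_def)
      finally have r: "run (\<pi> w) p q = \<delta> * \<lfloor>a / \<delta>\<rfloor> + \<delta> * \<lfloor>c / \<delta>\<rfloor> - (\<Sum>u\<leftarrow>us. \<Sum>v\<leftarrow>vs. H u v) / (real s)\<^sup>2" .
      define F where "F = measure_pmf.expectation U (\<lambda>u. measure_pmf.expectation U (\<lambda>v. f (pt (X p u), pt (X q v))))"
      have "measure_pmf.expectation U (\<lambda>v. f (pt (X p u), pt (X q v))) = Er u + (\<Sum>t<T. \<phi> t (pt (X p u)) * \<beta> t q)" for u
        by (simp add: Er_def H_def h_def[abs_def] \<beta>_def int)
      \<comment> \<open>The quantized expectation of \<open>f\<close> splits into the mean of the
        remainder and a bilinear form in the moments; only the former is estimated by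
        sampling.\<close>
      then have F: "F = measure_pmf.expectation U Er + (\<Sum>t<T. \<alpha> t p * \<beta> t q)"
        by (simp add: F_def \<alpha>_def int)
      have "(\<Sum>t<T. \<alpha>' t * \<beta> t q) - (\<Sum>t<T. \<alpha> t p * \<beta> t q) = (\<Sum>t<T. (\<alpha>' t - \<alpha> t p) * \<beta> t q)"
        by (simp add: left_diff_distrib sum_subtractf)
      also have "\<bar>\<dots>\<bar> \<le> (\<Sum>t<T. \<delta> * D)"
        using \<alpha>'_err \<beta> \<delta>(1) by (intro order_trans[OF sum_abs sum_mono], unfold abs_mult, intro mult_mono) auto
      finally have "\<bar>(\<Sum>t<T. \<alpha>' t * \<beta> t q) - (\<Sum>t<T. \<alpha> t p * \<beta> t q)\<bar> \<le> \<delta> * (real T * D)" by (simp add: mult_ac)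
      moreover have "\<delta> * (real T * D) + 2 * \<delta> \<le> \<epsilon> / 2" using \<delta>(2) by (simp add: algebra_simps)
      \<comment> \<open>Rounding contributes \<delta> D for each of the \<open>T\<close> moments and
        \<delta> for each of the two transmitted numbers.\<close>
      ultimately have "\<bar>run (\<pi> w) p q - F\<bar> \<le> \<epsilon> / 2 + \<epsilon> / 4"
        using dev floor_divide_error[OF \<delta>(1), of a] floor_divide_error[OF \<delta>(1), of c]
        unfolding r F a_def c_def by linarith
      moreover have "\<bar>integral\<^sup>L (p \<Otimes>\<^sub>M q) f - F\<bar> \<le> 2 * (\<epsilon> / 8)"
        unfolding F_def
      proof (rule integral_pair_quantized[OF p q cont f1 fin fin])
        fix t :: real assume t: "t \<in> {0..1}"
        show "\<bar>(\<integral>x. f (x, t) \<partial>p) - measure_pmf.expectation U (\<lambda>u. f (pt (X p u), t))\<bar> \<le> \<epsilon> / 8"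
          using t f1 lip(1)[OF t] by (intro X[OF p]) auto
        show "\<bar>(\<integral>y. f (t, y) \<partial>q) - measure_pmf.expectation U (\<lambda>v. f (t, pt (X q v)))\<bar> \<le> \<epsilon> / 8"
          using t f1 lip(2)[OF t] by (intro X[OF q]) auto
      qed (use pt XN p q in auto)
      ultimately show ?thesis unfolding w_def by linarith
    qed
    \<comment> \<open>Accuracy \<epsilon>/4 turns the factor 7 of \<open>debiased_estimator\<close>
      into the 28 of the hypothesis.\<close>
    have "2 / 3 \<le> measure_pmf.prob (pair_pmf (replicate_pmf s U) (replicate_pmf s U))
      {(us, vs). \<bar>(\<Sum>u\<leftarrow>us. Er u) / s + (\<Sum>v\<leftarrow>vs. Ec v) / s - (\<Sum>u\<leftarrow>us. \<Sum>v\<leftarrow>vs. H u v) / (real s)\<^sup>2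
          - measure_pmf.expectation U Er\<bar> \<le> \<epsilon> / 4}"
      unfolding Er_def Ec_def using \<epsilon> \<eta>(2) by (intro debiased_estimator[where \<eta> = \<eta>] fin H s) auto
    also have "\<dots> \<le> measure_pmf.prob (pair_pmf (replicate_pmf s U) (replicate_pmf s U))
      {w. \<bar>run (\<pi> w) p q - integral\<^sup>L (p \<Otimes>\<^sub>M q) f\<bar> \<le> \<epsilon>}"
      using est by (intro measure_pmf.finite_measure_mono_AE) (auto simp: AE_measure_pmf_iff set_replicate_pmf)
    finally show "2 / 3 \<le> measure_pmf.prob (pair_pmf (replicate_pmf s U) (replicate_pmf s U))
      {w. \<bar>run (\<pi> w) p q - integral\<^sup>L (p \<Otimes>\<^sub>M q) f\<bar> \<le> \<epsilon>}" .
  qed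
qed

section \<open>Smooth functions\<close>


lemma sum_lessThan_mult:
  fixes g :: "nat \<Rightarrow> 'a::comm_monoid_add"
  shows "(\<Sum>t<n * k. g t) = (\<Sum>c<n. \<Sum>i<k. g (c * k + i))"
proof -
  have "sum g {c * k..<c * k + k} = (\<Sum>i<k. g (c * k + i))" for c
    using sum.shift_bounds_nat_ivl[of g 0 "c * k" k] by (simp add: atLeast0LessThan add.commute)
  then show ?thesis by (simp flip: sum.nat_group)
qed

text \<open>Index \<open>t\<close> codes the cell \<open>t div k\<close> and the Taylor order
  \<open>t mod k\<close>. The factor \<phi> is a normalized monomial supported on the cell, and
  \<psi> is the derivative at the left endpoint. There are m + 1 cells because x = 1 forms one of
  its own.\<close>

lemma smooth_class_low_rank:
  assumes f: "f \<in> smooth_class k" and k: "1 \<le> k" and m: "0 < m"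
  obtains \<phi> \<psi> :: "nat \<Rightarrow> real \<Rightarrow> real" where
    "\<And>t x. t < (m + 1) * k \<Longrightarrow> x \<in> {0..1} \<Longrightarrow> \<phi> t x \<in> {0..1}"
    "\<And>t y. t < (m + 1) * k \<Longrightarrow> y \<in> {0..1} \<Longrightarrow> \<bar>\<psi> t y\<bar> \<le> derivative_bound k"
    "\<And>x y. x \<in> {0..1} \<Longrightarrow> y \<in> {0..1} \<Longrightarrow> \<bar>f (x, y) - (\<Sum>t<(m + 1) * k. \<phi> t x * \<psi> t y)\<bar> \<le> 1 / real m ^ k"
proof
  define \<phi> where "\<phi> = (\<lambda>t x. if nat \<lfloor>real m * x\<rfloor> = t div k
    then (x - real (t div k) / m) ^ (t mod k) / fact (t mod k) else 0)"
  define \<psi> where "\<psi> = (\<lambda>t y. (partial_x ^^ (t mod k)) f (real (t div k) / m, y))"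
  have grid: "real c / m \<in> {0..1}" if "c \<le> m" for c using that m by simp
  show "\<phi> t x \<in> {0..1}" if "t < (m + 1) * k" and x: "x \<in> {0..1}" for t x
  proof (cases "nat \<lfloor>real m * x\<rfloor> = t div k")
    case True
    then have d: "0 \<le> x - real (t div k) / m" "x - real (t div k) / m \<le> 1"
      using grid_point_le[OF m x] m by (auto intro: order_trans)
    then have "(x - real (t div k) / m) ^ (t mod k) \<le> 1" by (intro power_le_one)
    moreover have "1 \<le> (fact (t mod k) :: real)" by simp
    ultimately have "(x - real (t div k) / m) ^ (t mod k) \<le> fact (t mod k)" by linarith
    then show ?thesis using d True by (simp add: \<phi>_def)
  qed (simp add: \<phi>_def)
  show "\<bar>\<psi> t y\<bar> \<le> derivative_bound k" if "t < (m + 1) * k" and y: "y \<in> {0..1}" for t y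
  proof -
    have "t div k < m + 1" using that(1) by (rule less_mult_imp_div_less)
    then have "real (t div k) / m \<in> {0..1}" by (intro grid) simp
    then show ?thesis unfolding \<psi>_def using smooth_class_funpow_partial_x(3)[OF f _ y] k by simp
  qed
  show "\<bar>f (x, y) - (\<Sum>t<(m + 1) * k. \<phi> t x * \<psi> t y)\<bar> \<le> 1 / real m ^ k"
    if x: "x \<in> {0..1}" and y: "y \<in> {0..1}" for x y
  proof -
    define c where "c = nat \<lfloor>real m * x\<rfloor>"
    define z where "z = real c / m"
    have c: "c \<le> m" "0 \<le> x - z" "x - z \<le> 1 / m" using grid_point_le[OF m x] by (auto simp: c_def z_def)
    have z: "z \<in> {0..1}" unfolding z_def using c by (intro grid)
    have "(\<Sum>t<(m + 1) * k. \<phi> t x * \<psi> t y) = (\<Sum>b<m + 1. \<Sum>i<k. \<phi> (b * k + i) x * \<psi> (b * k + i) y)"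
      by (rule sum_lessThan_mult)
    \<comment> \<open>Only the cell containing \<open>x\<close> contributes, and its block is the
      Taylor polynomial at \<open>z\<close>.\<close>
    also have "\<dots> = (\<Sum>b<m + 1. if c = b then \<Sum>i<k. (partial_x ^^ i) f (z, y) * (x - z) ^ i / fact i else 0)"
    proof (intro sum.cong refl)
      fix b
      have \<phi>\<psi>: "\<phi> (b * k + i) x * \<psi> (b * k + i) y
        = (if c = b then (partial_x ^^ i) f (z, y) * (x - z) ^ i / fact i else 0)" if "i < k" for i
        using that by (simp add: \<phi>_def \<psi>_def z_def flip: c_def)
      show "(\<Sum>i<k. \<phi> (b * k + i) x * \<psi> (b * k + i) y)
        = (if c = b then \<Sum>i<k. (partial_x ^^ i) f (z, y) * (x - z) ^ i / fact i else 0)"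
        by (simp add: \<phi>\<psi>)
    qed
    also have "\<dots> = (\<Sum>i<k. (partial_x ^^ i) f (z, y) * (x - z) ^ i / fact i)" using c by simp
    \<comment> \<open>\<open>field_Taylor\<close> sums up to and including its order, so it is
      applied with k - 1; its remainder then involves the derivative of order
      \<open>k\<close>.\<close>
    also have "{..<k} = {..k - 1}" using k by auto
    finally have sum: "(\<Sum>t<(m + 1) * k. \<phi> t x * \<psi> t y)
      = (\<Sum>i\<le>k - 1. (partial_x ^^ i) f (z, y) * (x - z) ^ i / fact i)" .
    have "norm (f (x, y) - (\<Sum>i\<le>k - 1. (partial_x ^^ i) f (z, y) * (x - z) ^ i / fact i))
      \<le> 1 * norm (x - z) ^ Suc (k - 1) / fact (k - 1)"
    proof (rule field_Taylor[of "{0..1}" "k - 1" "\<lambda>i t. (partial_x ^^ i) f (t, y)", simplified funpow_0])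
      show "((\<lambda>t. (partial_x ^^ i) f (t, y)) has_real_derivative (partial_x ^^ Suc i) f (t, y)) (at t within {0..1})"
        if "t \<in> {0..1}" "i \<le> k - 1" for i t
        using smooth_class_funpow_partial_x(1)[OF f that(1) y] that(2) k by simp
      show "norm ((partial_x ^^ Suc (k - 1)) f (t, y)) \<le> 1" if "t \<in> {0..1}" for t
        using smooth_class_funpow_partial_x(2)[OF f that y] k by simp
    qed (use x z in auto)
    also have "\<dots> = (x - z) ^ k / fact (k - 1)" using c k by simp
    also have "\<dots> \<le> (x - z) ^ k / 1" using c by (intro divide_left_mono) auto
    also have "\<dots> \<le> (1 / m) ^ k" using c by (simp add: power_mono)
    finally show ?thesis unfolding sum by (simp add: power_one_over)
  qed
qed

section \<open>Choice of the parameters\<close>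

text \<open>With cells and samples both of order E =
  \<open>\<epsilon> powr (- 1 / (real k + 1))\<close>, the Taylor error divided by the sample size
  is of order \<epsilon>. The alphabet is polynomial in 1 / \<epsilon>, so a symbol costs
  logarithmically many bits.\<close>

lemma smooth_class_rand_comm_le:
  assumes f: "f \<in> smooth_class k" and k: "1 \<le> k" and \<epsilon>: "0 < \<epsilon>" "\<epsilon> \<le> 1"
  defines "D \<equiv> derivative_bound k"
  defines "G \<equiv> 3 * (3 * real k * D + 2)\<^sup>2 + 17 * D"
  shows "ereal_of_enat (rand_comm \<epsilon> f)
    \<le> ereal ((ln (5 * G) / ln 2 + 4) / ln 2 * (60 + 3 * real k) * ln (2 / \<epsilon>) * \<epsilon> powr (- 1 / (real k + 1)))"
proof -
  have D: "1 \<le> D" unfolding D_def by (rule derivative_bound_ge_1)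
  then have G: "1 \<le> G" unfolding G_def by (smt (verit) zero_le_power2)
  define E where "E = \<epsilon> powr (- 1 / (real k + 1))"
  have E1: "1 \<le> E" unfolding E_def using \<epsilon> powr_mono'[of "- 1 / (real k + 1)" 0 \<epsilon>] by simp
  have "E ^ (k + 1) = E powr real (k + 1)" using E1 by (subst powr_realpow) auto
  also have "\<dots> = \<epsilon> powr (- 1 / (real k + 1) * real (k + 1))" unfolding E_def by (rule powr_powr)
  also have "- 1 / (real k + 1) * real (k + 1) = - 1" by (simp add: field_simps)
  finally have E: "E ^ (k + 1) = 1 / \<epsilon>" using \<epsilon> by (simp add: powr_minus_divide)
  have "E ^ 1 \<le> E ^ (k + 1)" using E1 by (intro power_increasing) auto
  then have E\<epsilon>: "E \<le> 1 / \<epsilon>" using E by simp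
  define m where "m = nat \<lceil>E\<rceil>"
  have m: "E \<le> m" "real m \<le> E + 1" "0 < m" using E1 unfolding m_def by linarith+
  define \<eta> where "\<eta> = 1 / real m ^ k"
  have "E ^ k \<le> real m ^ k" using m E1 by (intro power_mono) auto
  then have "\<eta> \<le> 1 / E ^ k" unfolding \<eta>_def using E1 m(3) by (intro divide_left_mono) auto
  \<comment> \<open>This is the balance that determines the exponent: the Taylor error is at most
    \<epsilon> E, so order E samples reduce it to order \<epsilon>.\<close>
  also have "1 / E ^ k = \<epsilon> * E" using E E1 \<epsilon> by (simp add: field_simps)
  finally have \<eta>E: "\<eta> \<le> \<epsilon> * E" .
  have \<eta>1: "\<eta> \<le> 1" unfolding \<eta>_def using m by (simp add: one_le_power)
  define s where "s = nat \<lceil>28 * E\<rceil>"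
  have s: "28 * E \<le> s" "real s \<le> 28 * E + 1" "0 < s" using E1 unfolding s_def by linarith+
  have "28 * \<eta> \<le> \<epsilon> * (28 * E)" using \<eta>E by simp
  also have "\<dots> \<le> \<epsilon> * s" using s \<epsilon> by (intro mult_left_mono) auto
  finally have \<eta>s: "28 * \<eta> \<le> \<epsilon> * s" .
  define T where "T = (m + 1) * k"
  have "real (m + 1) * real k \<le> (3 * E) * real k" using m E1 by (intro mult_right_mono) auto
  then have T: "real T \<le> 3 * real k * E" by (simp add: T_def algebra_simps)
  define A where "A = 3 * real k * D + 2"
  have A: "2 \<le> A" using D by (simp add: A_def)
  have "real T * D \<le> (3 * real k * E) * D" using T D by (intro mult_right_mono) auto
  also have "\<dots> = 3 * real k * D * E" by simp
  finally have TD: "real T * D + 2 \<le> A * E" using E1 by (simp add: A_def algebra_simps)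
  have TD0: "2 \<le> real T * D + 2" using D by simp
  define \<delta> where "\<delta> = \<epsilon> / (2 * (real T * D + 2))"
  have \<delta>: "0 < \<delta>" "\<delta> * (real T * D + 2) \<le> \<epsilon> / 2" using TD0 \<epsilon> by (auto simp: \<delta>_def field_simps)
  define N where "N = nat \<lceil>16 * D / \<epsilon>\<rceil>"
  have "0 < 16 * D / \<epsilon>" "1 \<le> D / \<epsilon>" using D \<epsilon> by (auto simp: field_simps)
  \<comment> \<open>Rounding up adds at most 1, which D / \<epsilon> absorbs: 17 in place of
    16.\<close>
  then have N: "16 * D / \<epsilon> \<le> N" "real N \<le> 17 * (D / \<epsilon>)" "0 < N"
    unfolding N_def by linarith+
  have "\<epsilon> ^ 3 \<le> \<epsilon>" using \<epsilon> power_decreasing[of 1 3 \<epsilon>] by simp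
  then have "17 * D / \<epsilon> \<le> 17 * D / \<epsilon> ^ 3" using D \<epsilon> by (intro divide_left_mono) auto
  then have N3: "real N \<le> 17 * D / \<epsilon> ^ 3" using N by simp
  have "(real T * D + 2) / \<delta> = 2 * (real T * D + 2)\<^sup>2 / \<epsilon>"
    using TD0 \<epsilon> by (simp add: \<delta>_def power2_eq_square)
  also have "\<dots> \<le> 2 * (A * E)\<^sup>2 / \<epsilon>"
    using TD TD0 \<epsilon> by (intro divide_right_mono mult_left_mono power_mono) auto
  also have "\<dots> \<le> 2 * (A * (1 / \<epsilon>))\<^sup>2 / \<epsilon>"
    using A E1 E\<epsilon> \<epsilon> by (intro divide_right_mono mult_left_mono power_mono mult_mono) auto
  also have "\<dots> = 2 * A\<^sup>2 / \<epsilon> ^ 3" by (simp add: power2_eq_square power3_eq_cube)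
  finally have T\<delta>: "(real T * D + 2) / \<delta> \<le> 2 * A\<^sup>2 / \<epsilon> ^ 3" .
  have \<epsilon>3: "\<epsilon> ^ 3 \<le> 1" "0 < \<epsilon> ^ 3" using \<epsilon> by (auto intro: power_le_one)
  have "1 \<le> A\<^sup>2" using A by (simp add: one_le_power)
  then have "1 \<le> A\<^sup>2 / \<epsilon> ^ 3" using \<epsilon>3 by (simp add: pos_le_divide_eq)
  \<comment> \<open>In G, with \<open>A\<close> as above, 2 A^2 covers the range of the rounded
    messages, a third A^2 the added 1, and 17 D the grid indices. Bringing all of it over
    \<epsilon>^3 is crude but affects only a logarithm.\<close>
  define Z where "Z = nat \<lceil>G / \<epsilon> ^ 3\<rceil>"
  have "1 \<le> G / \<epsilon> ^ 3" using G \<epsilon>3 by (simp add: pos_le_divide_eq)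
  then have Z: "G / \<epsilon> ^ 3 \<le> Z" "2 * real Z + 1 \<le> 5 * (G / \<epsilon> ^ 3)" unfolding Z_def by linarith+
  have G_eq: "G / \<epsilon> ^ 3 = 3 * (A\<^sup>2 / \<epsilon> ^ 3) + 17 * D / \<epsilon> ^ 3"
    by (simp add: G_def A_def add_divide_distrib)
  have NZ: "N \<le> Z" using N3 Z(1) G_eq \<open>1 \<le> A\<^sup>2 / \<epsilon> ^ 3\<close> by linarith
  have "0 \<le> 17 * D / \<epsilon> ^ 3" using D \<epsilon>3 by simp
  then have TZ: "(real T * D + 2) / \<delta> + 1 \<le> real Z" using T\<delta> Z(1) G_eq \<open>1 \<le> A\<^sup>2 / \<epsilon> ^ 3\<close> by simp
  define b where "b = nat \<lceil>log 2 (5 * (G / \<epsilon> ^ 3))\<rceil>"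
  have G5: "1 \<le> 5 * (G / \<epsilon> ^ 3)" using \<open>1 \<le> G / \<epsilon> ^ 3\<close> by linarith
  have b: "log 2 (5 * (G / \<epsilon> ^ 3)) \<le> b" "b \<le> log 2 (5 * (G / \<epsilon> ^ 3)) + 1"
    using G5 unfolding b_def by (linarith, simp)
  have "5 * (G / \<epsilon> ^ 3) \<le> 2 powr b" using b(1) G5 by (subst (asm) log_le_iff) auto
  then have "real (2 * Z + 1) \<le> real (2 ^ b)" using Z(2) by (simp add: powr_realpow)
  then have Zb: "2 * Z + 1 \<le> 2 ^ b" by (simp only: of_nat_le_iff)
  have fcont: "continuous_on unit_square f"
    using differentiable_on_funpow_partial(1)[of k f 0] f k
    by (intro differentiable_imp_continuous_on) (simp add: smooth_class_def)
  have f1: "\<bar>f z\<bar> \<le> 1" if "z \<in> unit_square" for z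
    using f that by (auto simp: smooth_class_def abs_le_iff)
  obtain \<phi> \<psi> where \<phi>\<psi>: "\<And>t x. t < T \<Longrightarrow> x \<in> {0..1} \<Longrightarrow> \<phi> t x \<in> {0..1}"
    "\<And>t y. t < T \<Longrightarrow> y \<in> {0..1} \<Longrightarrow> \<bar>\<psi> t y\<bar> \<le> D"
    "\<And>x y. x \<in> {0..1} \<Longrightarrow> y \<in> {0..1} \<Longrightarrow> \<bar>f (x, y) - (\<Sum>t<T. \<phi> t x * \<psi> t y)\<bar> \<le> \<eta>"
    unfolding T_def D_def \<eta>_def by (rule smooth_class_low_rank[OF f k m(3)]) blast
  have "16 * D \<le> \<epsilon> * N" using N \<epsilon> by (simp add: field_simps)
  then have "rand_comm \<epsilon> f \<le> enat (b * (2 * s + T + 2))"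
    using smooth_class_lipschitz[OF f k]
    by (intro rand_comm_le_low_rank[OF fcont f1 _ _ \<phi>\<psi> \<eta>1 \<eta>s \<epsilon>(1) s(3) D N(3) _ \<delta> NZ TZ Zb, of D])
      (auto simp: D_def)
  then have "ereal_of_enat (rand_comm \<epsilon> f) \<le> ereal (real (b * (2 * s + T + 2)))"
    by (metis ereal_of_enat_le_iff ereal_of_enat_simps(1))
  moreover have "real (b * (2 * s + T + 2)) \<le> (ln (5 * G) / ln 2 + 4) / ln 2 * ln (2 / \<epsilon>) * ((60 + 3 * real k) * E)"
  proof -
    define l where "l = ln (2 / \<epsilon>)"
    have l: "l = ln 2 + ln (1 / \<epsilon>)" "0 \<le> ln (1 / \<epsilon>)" using \<epsilon> by (auto simp: l_def ln_div)
    have lnG: "0 \<le> ln (5 * G)" using G by (intro ln_ge_zero) auto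
    have "ln (5 * (G / \<epsilon> ^ 3)) = ln (5 * G) + 3 * ln (1 / \<epsilon>)"
      using G \<epsilon> by (simp add: ln_div ln_mult ln_realpow)
    then have "b \<le> (ln (5 * G) + 3 * ln (1 / \<epsilon>)) / ln 2 + 1" using b(2) by (simp add: log_def)
    \<comment> \<open>Additive constants are absorbed by 1 \<le> l / ln 2. Writing ln (2 /
      \<epsilon>) keeps the factor positive at \<epsilon> = 1.\<close>
    also have "\<dots> \<le> (ln (5 * G) * (l / ln 2) + 3 * l) / ln 2 + l / ln 2"
    proof (intro add_mono divide_right_mono)
      have "1 \<le> l / ln 2" using l by simp
      then show "1 \<le> l / ln 2" "ln (5 * G) \<le> ln (5 * G) * (l / ln 2)"
        using mult_left_mono[of 1 "l / ln 2" "ln (5 * G)"] lnG by auto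
      show "3 * ln (1 / \<epsilon>) \<le> 3 * l" using l by simp
    qed auto
    also have "\<dots> = (ln (5 * G) / ln 2 + 4) / ln 2 * l" by (simp add: field_simps)
    finally have bl: "real b \<le> (ln (5 * G) / ln 2 + 4) / ln 2 * l" .
    \<comment> \<open>The count is at most 56 E + 4 + 3 k E, and E is at least 1.\<close>
    have "real (2 * s + T + 2) \<le> (60 + 3 * real k) * E"
      using s(2) T E1 by (simp add: algebra_simps)
    then have "real b * real (2 * s + T + 2) \<le> ((ln (5 * G) / ln 2 + 4) / ln 2 * l) * ((60 + 3 * real k) * E)"
      using bl by (intro mult_mono) auto
    then show ?thesis by (simp only: l_def of_nat_mult)
  qed
  ultimately show ?thesis
    unfolding E_def[symmetric] by (smt (verit) ereal_less_eq(3) mult.assoc mult.commute order_trans)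
qed

theorem theorem3p16:
  fixes k :: nat
  assumes "k \<ge> 1"
  shows "\<exists>(C::real) (d::nat). \<forall>f\<in>smooth_class k. \<forall>\<epsilon>::real. 0 < \<epsilon> \<and> \<epsilon> \<le> 1 \<longrightarrow>
    ereal_of_enat (rand_comm \<epsilon> f)
      \<le> ereal (C * ln (2 / \<epsilon>) ^ d * \<epsilon> powr (- 1 / (real k + 1)))"
  \<comment> \<open>A single logarithmic factor suffices, d = 1, and the constant depends only on
    \<open>k\<close>.\<close>
  using smooth_class_rand_comm_le[OF _ assms] by (metis power_one_right)

end
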